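(* Let $(\mathcal{S},\mathcal{A},R,P_r,P_s,\mu_0,\gamma)$ be a discounted infinite-horizon Markov decision process satisfying, together with the policy below, the regularity assumptions listed in the context. For a push-forward policy $\pi(s,\xi;\theta_\pi)$ with base distribution $\mathscr{P}(\mathcal{X})$ and a differentiable utility function $\psi(\cdot)$, the policy gradient of the state utility function $\mathbb{E}_{s\sim\mu_0}V_\psi^{\pi_\theta}(s)$ is given by $$\nabla_{\theta_\pi}\,\mathbb{E}_{s\sim\mu_0}V_\psi^{\pi_\theta}(s)=\mathbb{E}_{s\sim d_{\mu_0}^{\pi},\ \xi\sim\mathscr{P}(\mathcal{X})}\Big[\nabla_{\theta_\pi}\pi(s,\xi;\theta_\pi)\cdot\nabla_a Q_\psi^{\pi_\theta}(s,a)\big|_{a=\pi(s,\xi;\theta_\pi)}\Big],$$ where $\pi_\theta$ is the stochastic policy induced by $\pi(\cdot,\cdot;\theta_\pi)$ and $d_{\mu_0}^{\pi}$ is the state occupancy measure of $\pi_\theta$.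
   Context: MDP. The state space $\mathcal{S}$ and the action space $\mathcal{A}$ are continuous, and $\mathcal{S}$ is compact. $P_s(\cdot|s,a)$ is the transition kernel, with density written $P(s'|s,a)$; $\mu_0$ is the initial state distribution, with density $\mu_0(s)$; $\gamma\in(0,1)$ is the discount factor; $R(s,a)\sim P_r(\cdot|s,a)$ is the random reward at the state-action pair $(s,a)$. Push-forward policy. $\mathscr{P}(\mathcal{X})$ is a fixed base probability distribution on $\mathcal{X}\subseteq\mathbb{R}^d$. A push-forward policy with parameters $\theta_\pi$ is a map $(s,\xi)\mapsto\pi(s,\xi;\theta_\pi)\in\mathcal{A}$; in state $s$ an action is generated by sampling $\xi\sim\mathscr{P}(\mathcal{X})$ and setting $a=\pi(s,\xi;\theta_\pi)$. The resulting conditional law of the action given $s$ is the stochastic policy $\pi_\theta(\cdot|s)$. $\nabla_{\theta_\pi}\pi(s,\xi;\theta_\pi)$ is the (transposed) Jacobian in $\theta_\pi$, and "$\cdot$" is its product with the vector $\nabla_aQ$ (chain rule). Value functions. For a stochastic policy $\pi$ and a utility function $\psi$ acting on rewards, $$Q_\psi^\pi(s,a):=\mathbb{E}\Big[\sum_{t=0}^\infty\gamma^t\psi(R(s_t,a_t))\Big],\quad s_0=s,\ a_0=a,\ s_{t+1}\sim P_s(\cdot|s_t,a_t),\ a_{t+1}\sim\pi(\cdot|s_{t+1}),$$ with the expectation also over the rewards, and $V_\psi^\pi(s):=\mathbb{E}_{a\sim\pi(\cdot|s)}[Q_\psi^\pi(s,a)]$. State occupancy measure. $d_{\mu_0}^{\pi}(s):=\sum_{t=0}^\infty\gamma^tP(s_t=s|\mu_0,\pi)$,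 where $P(s_t=\cdot\,|\mu_0,\pi)$ is the density of $s_t$ when $s_0\sim\mu_0$ and actions follow $\pi$. It is unnormalized, and $\mathbb{E}_{s\sim d_{\mu_0}^{\pi}}[f(s)]$ means $\int_{\mathcal{S}}f(s)\,d_{\mu_0}^{\pi}(s)\,\mathrm{d}s$. Regularity assumptions. (1) $P(s'|s,a)$, $\nabla_aP(s'|s,a)$, $\pi(s,\xi;\theta_\pi)$, $\nabla_{\theta_\pi}\pi(s,\xi;\theta_\pi)$, $R(s,a)$, $\nabla_aR(s,a)$ and $\mu_0(s)$ are continuous in all their parameters and variables. (2) There are bounds $B$ and $L$ such that $\sup_s\mu_0(s)<B$, $\sup_{a,s,s'}P(s'|s,a)<B$, $\sup_{a,s}|R(s,a)|<B$, $\sup_{a,s,s'}\|\nabla_aP(s'|s,a)\|<L$ and $\sup_{a,s}\|\nabla_aR(s,a)\|<L$.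
   Formalization: Assumes also that, locally in θ and uniformly in s, the norm of the policy's θ-Jacobian is at most a function of ξ integrable under the base law, and that ψ' is bounded on bounded sets (the claim fails without these); the action space is taken open. *)

theory Defs
  imports "HOL-Probability.Probability"
begin

section \<open>Gradients\<close>

definition gradient :: "('a::euclidean_space \<Rightarrow> real) \<Rightarrow> 'a \<Rightarrow> 'a" where
  "gradient f x = (THE D. GDERIV f x :> D)"

text \<open>The transposed Jacobian. Its type makes continuity and norms refer to the operator norm.\<close>

definition jacobian_transpose ::
    "('p::euclidean_space \<Rightarrow> 'a::euclidean_space) \<Rightarrow> 'p \<Rightarrow> 'a \<Rightarrow>\<^sub>L 'p" where
  "jacobian_transpose f x = Blinfun (adjoint (frechet_derivative f (at x)))"

lemma gradient_eqI:
  assumes "GDERIV f x :> D"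
  shows "gradient f x = D"
  unfolding gradient_def
proof (rule the_equality)
  show "GDERIV f x :> D" by fact
next
  fix E assume "GDERIV f x :> E"
  then have "(\<lambda>h. inner h E) = (\<lambda>h. inner h D)"
    using assms has_derivative_unique unfolding gderiv_def by blast
  then have "inner (E - D) E = inner (E - D) D" by (rule fun_cong)
  then have "inner (E - D) (E - D) = 0" by (simp only: inner_diff_right)
  then show "E = D" by simp
qed

lemma gderiv_gradient:
  assumes "f differentiable (at x)"
  shows "GDERIV f x :> gradient f x"
proof -
  obtain f' where f': "(f has_derivative f') (at x)"
    using assms by (auto simp: differentiable_def)
  then have "linear f'" by (rule has_derivative_linear)
  then have "f' h = inner h (adjoint f' 1)" for h
    using adjoint_works[of f' h 1] by simp
  then have "f' = (\<lambda>h. inner h (adjoint f' 1))" by (rule ext)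
  with f' have "GDERIV f x :> adjoint f' 1"
    unfolding gderiv_def by metis
  then show ?thesis by (metis gradient_eqI)
qed

lemma jacobian_transpose_inner:
  assumes "(f has_derivative f') (at x)"
  shows "inner (f' h) v = inner h (blinfun_apply (jacobian_transpose f x) v)"
proof -
  have eq: "frechet_derivative f (at x) = f'"
    using assms by (metis frechet_derivative_at)
  have lin: "linear f'" using assms by (rule has_derivative_linear)
  have "bounded_linear (adjoint f')"
    using adjoint_linear[OF lin] by (simp add: linear_conv_bounded_linear)
  then show ?thesis
    unfolding jacobian_transpose_def eq
    by (simp add: bounded_linear_Blinfun_apply adjoint_works[OF lin])
qed

section \<open>Markov decision processes with densities\<close>

text \<open>
  The reward at \<open>(s, a)\<close> is a random variable \<open>reward s a\<close> on a probability space \<open>noise\<close>, so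
  that it has realizations which can be continuous or differentiable in \<open>(s, a)\<close>;
  \<open>reward_kernel s a\<close> is its law. \<open>trans_density s' s a\<close> is the density \<open>P(s' | s, a)\<close>.
\<close>

record ('s, 'a, 'w) mdp =
  states :: "'s set"
  actions :: "'a set"
  noise :: "'w measure"
  reward :: "'s \<Rightarrow> 'a \<Rightarrow> 'w \<Rightarrow> real"
  reward_kernel :: "'s \<Rightarrow> 'a \<Rightarrow> real measure"
  trans_density :: "'s \<Rightarrow> 's \<Rightarrow> 'a \<Rightarrow> real"
  init_density :: "'s \<Rightarrow> real"
  discount :: real

definition state_space :: "('s::euclidean_space, 'a::euclidean_space, 'w) mdp \<Rightarrow> 's measure" where
  "state_space M = restrict_space lborel (states M)"

definition action_space :: "('s::euclidean_space, 'a::euclidean_space, 'w) mdp \<Rightarrow> 'a measure" where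
  "action_space M = restrict_space borel (actions M)"

definition trans_kernel ::
    "('s::euclidean_space, 'a::euclidean_space, 'w) mdp \<Rightarrow> 's \<Rightarrow> 'a \<Rightarrow> 's measure" where
  "trans_kernel M s a = density (state_space M) (\<lambda>s'. ennreal (trans_density M s' s a))"

definition init_law :: "('s::euclidean_space, 'a::euclidean_space, 'w) mdp \<Rightarrow> 's measure" where
  "init_law M = density (state_space M) (\<lambda>s. ennreal (init_density M s))"

text \<open>The action set is open, so that gradients with respect to the action make sense on it.\<close>

locale mdp =
  fixes M :: "('s::euclidean_space, 'a::euclidean_space, 'w) mdp"
  assumes compact_states: "compact (states M)"
    and open_actions: "open (actions M)"
    and prob_noise: "prob_space (noise M)"
    and measurable_reward: "(\<lambda>((s, a), w). reward M s a w)
          \<in> borel_measurable ((state_space M \<Otimes>\<^sub>M action_space M) \<Otimes>\<^sub>M noise M)"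
    and reward_kernel: "\<lbrakk>s \<in> states M; a \<in> actions M\<rbrakk>
          \<Longrightarrow> reward_kernel M s a = distr (noise M) borel (reward M s a)"
    and measurable_trans: "(\<lambda>((s, a), s'). trans_density M s' s a)
          \<in> borel_measurable ((state_space M \<Otimes>\<^sub>M action_space M) \<Otimes>\<^sub>M state_space M)"
    and trans_nonneg: "\<lbrakk>s' \<in> states M; s \<in> states M; a \<in> actions M\<rbrakk> \<Longrightarrow> 0 \<le> trans_density M s' s a"
    and prob_trans: "\<lbrakk>s \<in> states M; a \<in> actions M\<rbrakk> \<Longrightarrow> prob_space (trans_kernel M s a)"
    and measurable_init: "init_density M \<in> borel_measurable (state_space M)"
    and init_nonneg: "s \<in> states M \<Longrightarrow> 0 \<le> init_density M s"
    and prob_init: "prob_space (init_law M)"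
    and discount: "0 < discount M" "discount M < 1"

section \<open>Trajectories\<close>

text \<open>
  A trajectory is a sequence of triples (state, action, reward). Its law under a stochastic policy
  \<open>pol\<close>, given the law \<open>\<nu>\<close> of the first triple, is the Ionescu-Tulcea extension of the one-step
  kernels.
\<close>

definition step_space ::
    "('s::euclidean_space, 'a::euclidean_space, 'w) mdp \<Rightarrow> ('s \<times> 'a \<times> real) measure" where
  "step_space M = state_space M \<Otimes>\<^sub>M (action_space M \<Otimes>\<^sub>M borel)"

definition step_at ::
    "('s::euclidean_space, 'a::euclidean_space, 'w) mdp \<Rightarrow> 's \<Rightarrow> 'a \<Rightarrow> ('s \<times> 'a \<times> real) measure" where
  "step_at M s a = distr (reward_kernel M s a) (step_space M) (\<lambda>r. (s, a, r))"

definition step_from ::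
    "('s::euclidean_space, 'a::euclidean_space, 'w) mdp \<Rightarrow> ('s \<Rightarrow> 'a measure)
      \<Rightarrow> 's \<Rightarrow> ('s \<times> 'a \<times> real) measure" where
  "step_from M pol s = pol s \<bind> step_at M s"

definition next_step ::
    "('s::euclidean_space, 'a::euclidean_space, 'w) mdp \<Rightarrow> ('s \<Rightarrow> 'a measure)
      \<Rightarrow> 's \<times> 'a \<times> real \<Rightarrow> ('s \<times> 'a \<times> real) measure" where
  "next_step M pol = (\<lambda>(s, a, r). trans_kernel M s a \<bind> step_from M pol)"

definition traj_kernel ::
    "('s::euclidean_space, 'a::euclidean_space, 'w) mdp \<Rightarrow> ('s \<Rightarrow> 'a measure)
      \<Rightarrow> ('s \<times> 'a \<times> real) measure \<Rightarrow> nat \<Rightarrow> (nat \<Rightarrow> 's \<times> 'a \<times> real) \<Rightarrow> ('s \<times> 'a \<times> real) measure" where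
  "traj_kernel M pol \<nu> n h = (if n = 0 then \<nu> else next_step M pol (h (n - 1)))"

definition traj_law ::
    "('s::euclidean_space, 'a::euclidean_space, 'w) mdp \<Rightarrow> ('s \<Rightarrow> 'a measure)
      \<Rightarrow> ('s \<times> 'a \<times> real) measure \<Rightarrow> (nat \<Rightarrow> 's \<times> 'a \<times> real) measure" where
  "traj_law M pol \<nu> = projective_family.lim UNIV
     (Ionescu_Tulcea.CI (traj_kernel M pol \<nu>) (\<lambda>_. step_space M)) (\<lambda>_. step_space M)"

section \<open>Value functions and state occupancy\<close>

definition Q_value ::
    "('s::euclidean_space, 'a::euclidean_space, 'w) mdp \<Rightarrow> ('s \<Rightarrow> 'a measure)
      \<Rightarrow> (real \<Rightarrow> real) \<Rightarrow> 's \<Rightarrow> 'a \<Rightarrow> real" where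
  "Q_value M pol \<psi> s a =
     (\<integral>\<omega>. (\<Sum>t. discount M ^ t * \<psi> (snd (snd (\<omega> t)))) \<partial>traj_law M pol (step_at M s a))"

definition V_value ::
    "('s::euclidean_space, 'a::euclidean_space, 'w) mdp \<Rightarrow> ('s \<Rightarrow> 'a measure)
      \<Rightarrow> (real \<Rightarrow> real) \<Rightarrow> 's \<Rightarrow> real" where
  "V_value M pol \<psi> s = (\<integral>a. Q_value M pol \<psi> s a \<partial>pol s)"

definition state_utility ::
    "('s::euclidean_space, 'a::euclidean_space, 'w) mdp \<Rightarrow> ('s \<Rightarrow> 'a measure)
      \<Rightarrow> (real \<Rightarrow> real) \<Rightarrow> real" where
  "state_utility M pol \<psi> = (\<integral>s. V_value M pol \<psi> s \<partial>init_law M)"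

definition state_law ::
    "('s::euclidean_space, 'a::euclidean_space, 'w) mdp \<Rightarrow> ('s \<Rightarrow> 'a measure) \<Rightarrow> nat \<Rightarrow> 's measure" where
  "state_law M pol t =
     distr (traj_law M pol (init_law M \<bind> step_from M pol)) (state_space M) (\<lambda>\<omega>. fst (\<omega> t))"

definition state_density ::
    "('s::euclidean_space, 'a::euclidean_space, 'w) mdp \<Rightarrow> ('s \<Rightarrow> 'a measure) \<Rightarrow> nat \<Rightarrow> 's \<Rightarrow> real" where
  "state_density M pol t s = enn2real (RN_deriv (state_space M) (state_law M pol t) s)"

definition occupancy ::
    "('s::euclidean_space, 'a::euclidean_space, 'w) mdp \<Rightarrow> ('s \<Rightarrow> 'a measure) \<Rightarrow> 's \<Rightarrow> real" where
  "occupancy M pol s = (\<Sum>t. discount M ^ t * state_density M pol t s)"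

section \<open>Push-forward policies\<close>

definition push_forward ::
    "('s::euclidean_space, 'a::euclidean_space, 'w) mdp \<Rightarrow> 'x measure
      \<Rightarrow> ('s \<Rightarrow> 'x \<Rightarrow> 'p \<Rightarrow> 'a) \<Rightarrow> 'p \<Rightarrow> 's \<Rightarrow> 'a measure" where
  "push_forward M \<Xi> \<pi> \<theta> s = distr \<Xi> (action_space M) (\<lambda>\<xi>. \<pi> s \<xi> \<theta>)"

text \<open>The base distribution is \<open>\<Xi>\<close> on \<open>X\<close>, and the parameters range over an open set \<open>\<Theta>\<close>.\<close>

locale push_forward_policy =
  fixes M :: "('s::euclidean_space, 'a::euclidean_space, 'w) mdp"
    and X :: "'x::euclidean_space set"
    and \<Xi> :: "'x measure"
    and \<Theta> :: "'p::euclidean_space set"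
    and \<pi> :: "'s \<Rightarrow> 'x \<Rightarrow> 'p \<Rightarrow> 'a"
  assumes prob_base: "prob_space \<Xi>"
    and sets_base: "sets \<Xi> = sets (restrict_space borel X)"
    and open_params: "open \<Theta>"
    and policy_actions: "\<lbrakk>s \<in> states M; \<xi> \<in> X; \<theta> \<in> \<Theta>\<rbrakk> \<Longrightarrow> \<pi> s \<xi> \<theta> \<in> actions M"

section \<open>Regularity\<close>

definition regular_mdp :: "('s::euclidean_space, 'a::euclidean_space, 'w) mdp \<Rightarrow> bool" where
  "regular_mdp M \<longleftrightarrow>
     continuous_on (states M \<times> states M \<times> actions M) (\<lambda>(s', s, a). trans_density M s' s a) \<and>
     (\<forall>s'\<in>states M. \<forall>s\<in>states M. \<forall>a\<in>actions M. trans_density M s' s differentiable (at a)) \<and>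
     continuous_on (states M \<times> states M \<times> actions M) (\<lambda>(s', s, a). gradient (trans_density M s' s) a) \<and>
     (\<forall>w\<in>space (noise M).
        continuous_on (states M \<times> actions M) (\<lambda>(s, a). reward M s a w) \<and>
        (\<forall>s\<in>states M. \<forall>a\<in>actions M. (\<lambda>a. reward M s a w) differentiable (at a)) \<and>
        continuous_on (states M \<times> actions M) (\<lambda>(s, a). gradient (\<lambda>a. reward M s a w) a)) \<and>
     continuous_on (states M) (init_density M) \<and>
     (\<exists>B L.
        (\<forall>s\<in>states M. init_density M s < B) \<and>
        (\<forall>s'\<in>states M. \<forall>s\<in>states M. \<forall>a\<in>actions M.
           trans_density M s' s a < B \<and> norm (gradient (trans_density M s' s) a) < L) \<and>
        (\<forall>s\<in>states M. \<forall>a\<in>actions M. \<forall>w\<in>space (noise M).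
           \<bar>reward M s a w\<bar> < B \<and> norm (gradient (\<lambda>a. reward M s a w) a) < L))"

definition regular_policy ::
    "('s::euclidean_space, 'a::euclidean_space, 'w) mdp \<Rightarrow> 'x::euclidean_space set
      \<Rightarrow> 'p::euclidean_space set \<Rightarrow> ('s \<Rightarrow> 'x \<Rightarrow> 'p \<Rightarrow> 'a) \<Rightarrow> bool" where
  "regular_policy M X \<Theta> \<pi> \<longleftrightarrow>
     continuous_on (states M \<times> X \<times> \<Theta>) (\<lambda>(s, \<xi>, \<theta>). \<pi> s \<xi> \<theta>) \<and>
     (\<forall>s\<in>states M. \<forall>\<xi>\<in>X. \<forall>\<theta>\<in>\<Theta>. \<pi> s \<xi> differentiable (at \<theta>)) \<and>
     continuous_on (states M \<times> X \<times> \<Theta>) (\<lambda>(s, \<xi>, \<theta>). jacobian_transpose (\<pi> s \<xi>) \<theta>)"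

text \<open>
  Continuity of the Jacobian does not bound it when \<open>X\<close> is not compact, and without a bound the
  expectation over the base distribution need not be differentiable: take \<open>\<pi> s \<xi> \<theta> = \<theta> * \<xi>\<close> with
  \<open>\<xi>\<close> Cauchy distributed and the reward \<open>cos a\<close>, for which the expected reward is
  \<open>exp (- \<bar>\<theta>\<bar>)\<close>. The condition below is the one needed to differentiate under the
  expectation; it holds automatically for compact \<open>X\<close>.
\<close>

definition dominated_jacobian ::
    "('s::euclidean_space, 'a::euclidean_space, 'w) mdp \<Rightarrow> 'x::euclidean_space measure
      \<Rightarrow> 'p::euclidean_space set \<Rightarrow> ('s \<Rightarrow> 'x \<Rightarrow> 'p \<Rightarrow> 'a) \<Rightarrow> bool" where
  "dominated_jacobian M \<Xi> \<Theta> \<pi> \<longleftrightarrow>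
     (\<forall>\<theta>\<^sub>0\<in>\<Theta>. \<exists>U g. open U \<and> \<theta>\<^sub>0 \<in> U \<and> U \<subseteq> \<Theta> \<and> integrable \<Xi> g \<and>
        (\<forall>\<theta>\<in>U. \<forall>s\<in>states M. \<forall>\<xi>\<in>space \<Xi>. norm (jacobian_transpose (\<pi> s \<xi>) \<theta>) \<le> g \<xi>))"

text \<open>
  Mere differentiability does not make the derivative of a utility function bounded on the range of
  the rewards (consider \<open>x\<^sup>2 * sin (1 / x\<^sup>2)\<close>), and then the expectations in the policy gradient need
  not exist. Continuously differentiable functions satisfy the condition below.
\<close>

definition locally_bounded_deriv :: "(real \<Rightarrow> real) \<Rightarrow> bool" where
  "locally_bounded_deriv \<psi> \<longleftrightarrow> (\<forall>K. bounded K \<longrightarrow> bounded (deriv \<psi> ` K))"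

lemma locally_bounded_deriv_C1:
  assumes "continuous_on UNIV (deriv \<psi>)"
  shows "locally_bounded_deriv \<psi>"
  unfolding locally_bounded_deriv_def
proof (intro allI impI)
  fix K :: "real set" assume "bounded K"
  then have "compact (closure K)" by simp
  then have "bounded (deriv \<psi> ` closure K)"
    using assms by (intro compact_imp_bounded compact_continuous_image)
      (auto intro: continuous_on_subset)
  then show "bounded (deriv \<psi> ` K)"
    by (rule bounded_subset) (use closure_subset in blast)
qed

lemma dominated_jacobian_compact:
  assumes "mdp M" "push_forward_policy M X \<Xi> \<Theta> \<pi>" "regular_policy M X \<Theta> \<pi>" "compact X"
  shows "dominated_jacobian M \<Xi> \<Theta> \<pi>"
  unfolding dominated_jacobian_def
proof
  interpret mdp M by fact
  interpret push_forward_policy M X \<Xi> \<Theta> \<pi> by fact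
  interpret prob_space \<Xi> by (rule prob_base)
  have X: "space \<Xi> = X"
    using sets_eq_imp_space_eq[OF sets_base] by (simp add: space_restrict_space)
  fix \<theta>\<^sub>0 assume "\<theta>\<^sub>0 \<in> \<Theta>"
  then obtain e where e: "0 < e" "cball \<theta>\<^sub>0 e \<subseteq> \<Theta>"
    using open_params by (meson open_contains_cball)
  let ?K = "states M \<times> X \<times> cball \<theta>\<^sub>0 e"
  let ?J = "\<lambda>(s, \<xi>, \<theta>). jacobian_transpose (\<pi> s \<xi>) \<theta>"
  have "continuous_on (states M \<times> X \<times> \<Theta>) ?J"
    using assms(3) by (simp add: regular_policy_def)
  then have "continuous_on ?K ?J"
    by (rule continuous_on_subset) (use e in auto)
  moreover have "compact ?K"
    using compact_states assms(4) by (intro compact_Times) auto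
  ultimately have "bounded (?J ` ?K)"
    by (intro compact_imp_bounded compact_continuous_image)
  then obtain C where C: "\<And>z. z \<in> ?J ` ?K \<Longrightarrow> norm z \<le> C"
    unfolding bounded_iff by blast
  have "norm (jacobian_transpose (\<pi> s \<xi>) \<theta>) \<le> C"
    if "\<theta> \<in> ball \<theta>\<^sub>0 e" "s \<in> states M" "\<xi> \<in> space \<Xi>" for s \<xi> \<theta>
  proof (rule C)
    have "(s, \<xi>, \<theta>) \<in> ?K" using that X by auto
    then show "jacobian_transpose (\<pi> s \<xi>) \<theta> \<in> ?J ` ?K" by (rule rev_image_eqI) simp
  qed
  moreover have "ball \<theta>\<^sub>0 e \<subseteq> \<Theta>" using e(2) ball_subset_cball by blast
  ultimately show "\<exists>U g. open U \<and> \<theta>\<^sub>0 \<in> U \<and> U \<subseteq> \<Theta> \<and> integrable \<Xi> g \<and>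
        (\<forall>\<theta>\<in>U. \<forall>s\<in>states M. \<forall>\<xi>\<in>space \<Xi>. norm (jacobian_transpose (\<pi> s \<xi>) \<theta>) \<le> g \<xi>)"
    using e(1) by (intro exI[of _ "ball \<theta>\<^sub>0 e"] exI[of _ "\<lambda>_. C"]) auto
qed

section \<open>Well-formedness of the trajectory law\<close>

context mdp
begin

lemma space_state_space: "space (state_space M) = states M"
  by (simp add: state_space_def space_restrict_space)

lemma space_action_space: "space (action_space M) = actions M"
  by (simp add: action_space_def space_restrict_space)

lemma measurable_reward_kernel:
  "(\<lambda>(s, a). reward_kernel M s a) \<in> state_space M \<Otimes>\<^sub>M action_space M \<rightarrow>\<^sub>M prob_algebra borel"
proof -
  have "(\<lambda>z. distr (noise M) borel (\<lambda>w. reward M (fst z) (snd z) w))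
      \<in> state_space M \<Otimes>\<^sub>M action_space M \<rightarrow>\<^sub>M prob_algebra borel"
    using measurable_reward prob_noise
    by (intro measurable_distr_prob_space2[where M = "noise M"])
      (auto simp: split_beta' space_prob_algebra)
  then show ?thesis
    by (rule measurable_cong[THEN iffD1, rotated])
      (auto simp: space_pair_measure space_state_space space_action_space reward_kernel)
qed

lemma measurable_trans_kernel:
  "(\<lambda>(s, a). trans_kernel M s a) \<in> state_space M \<Otimes>\<^sub>M action_space M \<rightarrow>\<^sub>M prob_algebra (state_space M)"
proof (rule measurable_prob_algebraI)
  let ?SA = "state_space M \<Otimes>\<^sub>M action_space M"
  interpret S: sigma_finite_measure "state_space M"
    unfolding state_space_def
    using compact_states by (intro sigma_finite_measure_restrict_space lborel.sigma_finite_measure_axioms)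
      (auto intro: borel_compact)
  note measurable_trans[measurable]
  show prob: "prob_space (case z of (s, a) \<Rightarrow> trans_kernel M s a)" if "z \<in> space ?SA" for z
    using that prob_trans by (auto simp: space_pair_measure space_state_space space_action_space)
  show "(\<lambda>(s, a). trans_kernel M s a) \<in> ?SA \<rightarrow>\<^sub>M subprob_algebra (state_space M)"
  proof (rule measurable_subprob_algebra)
    fix z assume "z \<in> space ?SA"
    then show "subprob_space (case z of (s, a) \<Rightarrow> trans_kernel M s a)"
      by (intro prob_space_imp_subprob_space prob)
    show "sets (case z of (s, a) \<Rightarrow> trans_kernel M s a) = sets (state_space M)"
      by (auto simp: trans_kernel_def split: prod.split)
  next
    fix A assume [measurable]: "A \<in> sets (state_space M)"
    have "(\<lambda>z. \<integral>\<^sup>+s'. ennreal (trans_density M s' (fst z) (snd z)) * indicator A s' \<partial>state_space M)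
        \<in> borel_measurable ?SA"
      using measurable_trans by (intro S.borel_measurable_nn_integral) (simp add: split_beta')
    then show "(\<lambda>z. emeasure (case z of (s, a) \<Rightarrow> trans_kernel M s a) A) \<in> borel_measurable ?SA"
    proof (rule measurable_cong[THEN iffD1, rotated])
      fix z assume z: "z \<in> space ?SA"
      have "(\<lambda>s'. trans_density M s' (fst z) (snd z)) \<in> borel_measurable (state_space M)"
        using measurable_compose[OF measurable_Pair1'[OF z] measurable_trans] by (simp add: split_beta')
      then show "(\<integral>\<^sup>+s'. ennreal (trans_density M s' (fst z) (snd z)) * indicator A s' \<partial>state_space M)
          = emeasure (case z of (s, a) \<Rightarrow> trans_kernel M s a) A"
        by (simp add: trans_kernel_def emeasure_density split_beta)
    qed
  qed
qed

lemma measurable_step_at: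
  "(\<lambda>(s, a). step_at M s a) \<in> state_space M \<Otimes>\<^sub>M action_space M \<rightarrow>\<^sub>M prob_algebra (step_space M)"
  unfolding step_at_def step_space_def split_beta'
  using measurable_reward_kernel
  by (intro measurable_distr_prob_space2[where M = borel]) (auto simp: split_beta')

lemma measurable_step_from:
  assumes "pol \<in> state_space M \<rightarrow>\<^sub>M prob_algebra (action_space M)"
  shows "step_from M pol \<in> state_space M \<rightarrow>\<^sub>M prob_algebra (step_space M)"
  unfolding step_from_def
  by (rule measurable_bind_prob_space2[OF assms measurable_step_at])

lemma init_law_prob_algebra: "init_law M \<in> space (prob_algebra (state_space M))"
  using prob_init by (simp add: space_prob_algebra init_law_def)

lemma step_at_prob_algebra:
  assumes "s \<in> states M" "a \<in> actions M"
  shows "step_at M s a \<in> space (prob_algebra (step_space M))"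
  using measurable_space[OF measurable_step_at, of "(s, a)"] assms
  by (simp add: space_pair_measure space_state_space space_action_space)

lemma init_step_prob_algebra:
  assumes "pol \<in> state_space M \<rightarrow>\<^sub>M prob_algebra (action_space M)"
  shows "init_law M \<bind> step_from M pol \<in> space (prob_algebra (step_space M))"
  using measurable_bind_prob_space[OF measurable_const[OF init_law_prob_algebra]
      measurable_step_from[OF assms], of "count_space UNIV"]
  by (auto dest!: measurable_space)

lemma measurable_next_step:
  assumes "pol \<in> state_space M \<rightarrow>\<^sub>M prob_algebra (action_space M)"
  shows "next_step M pol \<in> step_space M \<rightarrow>\<^sub>M prob_algebra (step_space M)"
proof -
  have "(\<lambda>z. (fst z, fst (snd z))) \<in> step_space M \<rightarrow>\<^sub>M state_space M \<Otimes>\<^sub>M action_space M"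
    unfolding step_space_def by measurable
  from measurable_compose[OF this measurable_trans_kernel]
  have "(\<lambda>z. trans_kernel M (fst z) (fst (snd z))) \<in> step_space M \<rightarrow>\<^sub>M prob_algebra (state_space M)"
    by simp
  from measurable_bind_prob_space[OF this measurable_step_from[OF assms]]
  show ?thesis by (simp add: next_step_def split_beta')
qed

lemma Ionescu_Tulcea_traj:
  assumes pol: "pol \<in> state_space M \<rightarrow>\<^sub>M prob_algebra (action_space M)"
    and \<nu>: "\<nu> \<in> space (prob_algebra (step_space M))"
  shows "Ionescu_Tulcea (traj_kernel M pol \<nu>) (\<lambda>_. step_space M)"
proof -
  have *: "traj_kernel M pol \<nu> n \<in> PiM {0..<n} (\<lambda>_. step_space M) \<rightarrow>\<^sub>M prob_algebra (step_space M)" for n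
  proof (cases n)
    case 0
    then have "traj_kernel M pol \<nu> n = (\<lambda>_. \<nu>)"
      by (simp add: traj_kernel_def fun_eq_iff)
    then show ?thesis using \<nu> by simp
  next
    case (Suc m)
    have "(\<lambda>h. h m) \<in> PiM {0..<n} (\<lambda>_. step_space M) \<rightarrow>\<^sub>M step_space M"
      using Suc by (intro measurable_component_singleton) auto
    note measurable_compose[OF this measurable_next_step[OF pol]]
    moreover have "traj_kernel M pol \<nu> n = (\<lambda>h. next_step M pol (h m))"
      using Suc by (simp add: traj_kernel_def fun_eq_iff)
    ultimately show ?thesis by simp
  qed
  show ?thesis
    using measurable_prob_algebraD[OF *] measurable_space[OF *]
    by (intro Ionescu_Tulcea.intro) (auto simp: space_prob_algebra)
qed

end

lemma measurable_push_forward: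
  assumes "mdp M" "push_forward_policy M X \<Xi> \<Theta> \<pi>" "regular_policy M X \<Theta> \<pi>" "\<theta> \<in> \<Theta>"
  shows "push_forward M \<Xi> \<pi> \<theta> \<in> state_space M \<rightarrow>\<^sub>M prob_algebra (action_space M)"
proof -
  interpret mdp M by fact
  interpret push_forward_policy M X \<Xi> \<Theta> \<pi> by fact
  have X: "space \<Xi> = X"
    using sets_eq_imp_space_eq[OF sets_base] by (simp add: space_restrict_space)
  have "continuous_on (states M \<times> X \<times> \<Theta>) (\<lambda>(s, \<xi>, \<theta>). \<pi> s \<xi> \<theta>)"
    using assms(3) by (simp add: regular_policy_def)
  moreover have "continuous_on (states M \<times> X) (\<lambda>z. (fst z, snd z, \<theta>))"
    by (intro continuous_intros)
  ultimately have "continuous_on (states M \<times> X) (\<lambda>z. case (fst z, snd z, \<theta>) of (s, \<xi>, \<theta>) \<Rightarrow> \<pi> s \<xi> \<theta>)"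
    by (rule continuous_on_compose2) (use assms(4) in auto)
  then have "continuous_on (states M \<times> X) (\<lambda>(s, \<xi>). \<pi> s \<xi> \<theta>)"
    by (simp add: split_beta')
  then have "(\<lambda>(s, \<xi>). \<pi> s \<xi> \<theta>) \<in> borel_measurable (restrict_space borel (states M \<times> X))"
    by (rule borel_measurable_continuous_on_restrict)
  moreover have "(\<lambda>z. (fst z, snd z)) \<in> state_space M \<Otimes>\<^sub>M \<Xi> \<rightarrow>\<^sub>M restrict_space borel (states M \<times> X)"
  proof (rule measurable_restrict_space2)
    show "(\<lambda>z. (fst z, snd z)) \<in> space (state_space M \<Otimes>\<^sub>M \<Xi>) \<rightarrow> states M \<times> X"
      by (auto simp: space_pair_measure X space_state_space)
    have "(\<lambda>s. s) \<in> state_space M \<rightarrow>\<^sub>M borel"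
      unfolding state_space_def by (rule measurable_restrict_space1) simp
    moreover have "(\<lambda>\<xi>. \<xi>) \<in> \<Xi> \<rightarrow>\<^sub>M borel"
      unfolding measurable_cong_sets[OF sets_base refl] by (rule measurable_restrict_space1) simp
    ultimately show "(\<lambda>z. (fst z, snd z)) \<in> state_space M \<Otimes>\<^sub>M \<Xi> \<rightarrow>\<^sub>M borel"
      by (intro borel_measurable_Pair measurable_compose[OF measurable_fst]
          measurable_compose[OF measurable_snd])
  qed
  ultimately have "(\<lambda>z. case (fst z, snd z) of (s, \<xi>) \<Rightarrow> \<pi> s \<xi> \<theta>) \<in> borel_measurable (state_space M \<Otimes>\<^sub>M \<Xi>)"
    by (rule measurable_compose[rotated])
  then have "(\<lambda>(s, \<xi>). \<pi> s \<xi> \<theta>) \<in> borel_measurable (state_space M \<Otimes>\<^sub>M \<Xi>)"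
    by (simp add: split_beta')
  then have "(\<lambda>(s, \<xi>). \<pi> s \<xi> \<theta>) \<in> state_space M \<Otimes>\<^sub>M \<Xi> \<rightarrow>\<^sub>M action_space M"
    unfolding action_space_def
    using policy_actions assms(4)
    by (intro measurable_restrict_space2) (auto simp: space_pair_measure X space_state_space)
  then show ?thesis
    unfolding push_forward_def using prob_base
    by (intro measurable_distr_prob_space2[where M = \<Xi>]) (auto simp: space_prob_algebra)
qed

end

theory Submission
  imports Defs
begin

text \<open>
  The marginals of the trajectory law are obtained by iterating the one-step kernel, so that the
  action value \<open>Q\<close> satisfies the Bellman equation: expected utility plus \<open>\<gamma>\<close> times an integral of
  \<open>V\<close> against the transition density. Both terms can be differentiated under the integral.

  The gradient of \<open>V\<close> in \<open>\<theta>\<close> is never computed. For nearby parameters \<open>\<theta>'\<close>, the difference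
  \<open>W = V\<^sub>\<theta>\<^sub>' - V\<^sub>\<theta>\<close> solves \<open>W = A + \<gamma> T\<^sub>\<theta>\<^sub>' W\<close>, where \<open>T\<close> is the transition operator of the policy and
  \<open>A s = E[Q\<^sub>\<theta> s (\<pi> s \<xi> \<theta>') - Q\<^sub>\<theta> s (\<pi> s \<xi> \<theta>)]\<close>. Hence \<open>W = O(\<bar>\<theta>' - \<theta>\<bar>)\<close> uniformly, and
  \<open>W - \<gamma> T\<^sub>\<theta> W = A + \<gamma> (T\<^sub>\<theta>\<^sub>' - T\<^sub>\<theta>) W = A + O(\<bar>\<theta>' - \<theta>\<bar>\<^sup>2)\<close>. Integrating against the occupancy measure
  of \<open>\<theta>\<close>, which turns \<open>f - \<gamma> T\<^sub>\<theta> f\<close> into the initial expectation of \<open>f\<close>, leaves the integral of \<open>A\<close>,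
  where only the explicit dependence on \<open>\<theta>'\<close> has to be differentiated.
\<close>

section \<open>Differentiation under the integral sign\<close>

text \<open>The obstacle is that \<theta> enters every step of the trajectory, so differentiating V
  would mean interchanging a gradient with the infinite discounted series. Working with increments
  avoids this, and differentiability of the state utility comes out as part of the conclusion. The
  quadratic error rests on one fact: for a merely bounded measurable \<open>f\<close>, the
  expectation of \<open>f\<close> at the next state is differentiable in the action, with gradient
  bounded by a constant times the supremum of \<bar>f\<bar>, because the derivative falls on the
  transition density. Applied to W, which is itself of the order of \<bar>\<theta>' -
  \<theta>\<bar>, this makes the difference of the two transition operators a product of two small
  factors. Each factor costs one expectation of the Jacobian bound \<open>g\<close>, so
  integrability of \<open>g\<close> suffices and no second moment occurs.\<close>

lemma GDERIV_imp_bounded_diff: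
  fixes f :: "'a::real_inner \<Rightarrow> real"
  assumes "convex S" "\<And>x. x \<in> S \<Longrightarrow> GDERIV f x :> G x" "\<And>x. x \<in> S \<Longrightarrow> norm (G x) \<le> C"
    and "x \<in> S" "y \<in> S"
  shows "\<bar>f x - f y\<bar> \<le> C * norm (x - y)"
proof -
  have "onorm (\<lambda>h. inner h (G z)) \<le> C" if "z \<in> S" for z
  proof (rule onorm_bound)
    show "0 \<le> C" using assms(3)[OF that] norm_ge_zero order_trans by blast
    fix h
    have "norm (inner h (G z)) \<le> norm h * norm (G z)"
      using Cauchy_Schwarz_ineq2 by auto
    also have "\<dots> \<le> norm h * C"
      using assms(3)[OF that] by (intro mult_left_mono) auto
    finally show "norm (inner h (G z)) \<le> C * norm h" by (simp add: mult.commute)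
  qed
  moreover have "(f has_derivative (\<lambda>h. inner h (G z))) (at z within S)" if "z \<in> S" for z
    using assms(2)[OF that] has_derivative_at_withinI unfolding gderiv_def by blast
  ultimately have "norm (f x - f y) \<le> C * norm (x - y)"
    using assms(1,4,5) by (intro differentiable_bound[where f' = "\<lambda>z h. inner h (G z)"])
  then show ?thesis by simp
qed

text \<open>Presents gradients as limits of sequences of difference quotients, the form in which
  measurability and bounds pass to the limit.\<close>

lemma GDERIV_directional_LIMSEQ:
  fixes f :: "'a::real_inner \<Rightarrow> real"
  assumes "GDERIV f x :> D" and "t \<longlonglongrightarrow> 0" and "\<And>n. t n \<noteq> (0::real)"
  shows "(\<lambda>n. (f (x + t n *\<^sub>R h) - f x) / t n) \<longlonglongrightarrow> inner h D"
proof -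
  have "((\<lambda>s. f (x + s *\<^sub>R h)) has_derivative (\<lambda>s. inner (s *\<^sub>R h) D)) (at 0)"
    using assms(1) unfolding gderiv_def
    by (intro has_derivative_compose[of "\<lambda>s. x + s *\<^sub>R h" _ 0 UNIV f])
      (auto intro!: derivative_eq_intros)
  then have "((\<lambda>s. f (x + s *\<^sub>R h)) has_real_derivative inner h D) (at 0)"
    by (simp add: has_field_derivative_def mult_commute_abs)
  then have "((\<lambda>s. (f (x + s *\<^sub>R h) - f x) / s) \<longlongrightarrow> inner h D) (at 0)"
    by (simp add: DERIV_def)
  moreover have "filterlim t (at 0) sequentially"
    using assms(2,3) by (simp add: filterlim_at)
  ultimately show ?thesis by (rule filterlim_compose)
qed

text \<open>Tested in its own direction, the gradient yields difference quotients that tend to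
  \<open>inner D D\<close> and stay below \<open>C * norm D\<close>.\<close>

lemma norm_GDERIV_le:
  fixes f :: "'a::real_inner \<Rightarrow> real"
  assumes D: "GDERIV f x :> D" and "0 < e" "0 \<le> C"
    and lip: "\<And>y. y \<in> ball x e \<Longrightarrow> \<bar>f y - f x\<bar> \<le> C * norm (y - x)"
  shows "norm D \<le> C"
proof (cases "D = 0")
  case True
  then show ?thesis using assms by simp
next
  case False
  \<comment> \<open>The factor \<open>e / (2 * norm D)\<close> keeps every point
    \<open>x + t n *\<^sub>R D\<close> within distance \<open>e / 2\<close> of \<open>x\<close>,
    inside the ball where the Lipschitz bound holds.\<close>
  define t where "t n = e / (2 * norm D) / real (Suc n)" for n
  have t: "t n > 0" for n using \<open>0 < e\<close> False by (simp add: t_def)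
  have "t \<longlonglongrightarrow> 0"
    unfolding t_def by (rule lim_const_over_n[THEN LIMSEQ_Suc])
  with t have lim: "(\<lambda>n. (f (x + t n *\<^sub>R D) - f x) / t n) \<longlonglongrightarrow> inner D D"
    by (intro GDERIV_directional_LIMSEQ[OF D]) (auto simp: less_le)
  have "(f (x + t n *\<^sub>R D) - f x) / t n \<le> C * norm D" for n
  proof -
    have "t n * norm D = e / 2 / real (Suc n)"
      using False by (simp add: t_def)
    also have "\<dots> \<le> e / 2" using \<open>0 < e\<close> by (simp add: field_simps)
    also have "\<dots> < e" using \<open>0 < e\<close> by simp
    finally have "x + t n *\<^sub>R D \<in> ball x e"
      using t[of n] by (simp add: dist_norm)
    from lip[OF this] have "f (x + t n *\<^sub>R D) - f x \<le> C * (t n * norm D)"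
      using t[of n] by simp
    then show ?thesis using t[of n] by (simp add: field_simps)
  qed
  then have "inner D D \<le> C * norm D"
    by (intro LIMSEQ_le_const2[OF lim]) auto
  then show ?thesis using False by (simp add: dot_square_norm power2_eq_square)
qed

text \<open>Domination is imposed on the increments from \<open>x\<close>, so differentiability is
  required only at \<open>x\<close> itself; measurability of \<open>G\<close> is derived rather than
  assumed.\<close>

lemma dominated_GDERIV:
  fixes f :: "'a::euclidean_space \<Rightarrow> 'z \<Rightarrow> real"
  assumes e: "0 < e"
    and int: "\<And>y. y \<in> ball x e \<Longrightarrow> integrable N (f y)"
    and G: "\<And>z. z \<in> space N \<Longrightarrow> GDERIV (\<lambda>y. f y z) x :> G z"
    and g: "integrable N g" "\<And>z. z \<in> space N \<Longrightarrow> 0 \<le> g z"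
    and lip: "\<And>y z. y \<in> ball x e \<Longrightarrow> z \<in> space N \<Longrightarrow> \<bar>f y z - f x z\<bar> \<le> g z * norm (y - x)"
  shows "integrable N G"
    and "GDERIV (\<lambda>y. \<integral>z. f y z \<partial>N) x :> (\<integral>z. G z \<partial>N)"
    and "norm (\<integral>z. G z \<partial>N) \<le> (\<integral>z. g z \<partial>N)"
proof -
  have le: "norm (G z) \<le> g z" if "z \<in> space N" for z
    using G[OF that] e g(2)[OF that] lip[OF _ that] by (rule norm_GDERIV_le)
  \<comment> \<open>Each coordinate of \<open>G\<close> is a pointwise limit of measurable
    difference quotients along a basis vector.\<close>
  have meas: "G \<in> borel_measurable N"
    unfolding borel_measurable_euclidean_space[of G]
  proof
    fix i :: 'a assume i: "i \<in> Basis"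
    define t where "t n = e / 2 / real (Suc n)" for n
    have t: "t n > 0" for n using e by (simp add: t_def)
    have "t n \<le> e / 2" for n using e by (simp add: t_def field_simps)
    then have ball: "x + t n *\<^sub>R i \<in> ball x e" for n
      using t[of n] e i by (simp add: dist_norm) (smt (verit) field_sum_of_halves)
    have x: "x \<in> ball x e" using e by simp
    have "t \<longlonglongrightarrow> 0"
      unfolding t_def by (rule lim_const_over_n[THEN LIMSEQ_Suc])
    show "(\<lambda>z. inner (G z) i) \<in> borel_measurable N"
    proof (rule borel_measurable_LIMSEQ_real)
      show "(\<lambda>z. (f (x + t n *\<^sub>R i) z - f x z) / t n) \<in> borel_measurable N" for n
        using borel_measurable_integrable[OF int[OF ball[of n]]] borel_measurable_integrable[OF int[OF x]]
        by measurable
      fix z assume "z \<in> space N"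
      then show "(\<lambda>n. (f (x + t n *\<^sub>R i) z - f x z) / t n) \<longlonglongrightarrow> inner (G z) i"
        using t \<open>t \<longlonglongrightarrow> 0\<close> GDERIV_directional_LIMSEQ[OF G, of z t i]
        by (simp add: inner_commute less_imp_neq[THEN not_sym])
    qed
  qed
  show G_int: "integrable N G"
    using g(1) meas by (rule Bochner_Integration.integrable_bound) (use le g(2) in \<open>auto intro!: AE_I2\<close>)
  show "norm (\<integral>z. G z \<partial>N) \<le> (\<integral>z. g z \<partial>N)"
    using integral_norm_bound[of N G] integral_mono[OF integrable_norm[OF G_int] g(1) le] by linarith
  have x: "x \<in> ball x e" using e by simp
  show "GDERIV (\<lambda>y. \<integral>z. f y z \<partial>N) x :> (\<integral>z. G z \<partial>N)"
    unfolding gderiv_def has_derivative_iff_norm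
  proof
    show "bounded_linear (\<lambda>h. inner h (\<integral>z. G z \<partial>N))" by (rule bounded_linear_inner_left)
    let ?q = "\<lambda>y z. (f y z - f x z - inner (y - x) (G z)) / norm (y - x)"
    \<comment> \<open>Dominated convergence concerns sequences, so the limit is tested along
      sequences; staying in the ball keeps \<open>f y\<close> integrable.\<close>
    have "((\<lambda>y. norm (\<integral>z. ?q y z \<partial>N)) \<longlongrightarrow> 0) (at x within ball x e)"
      unfolding tendsto_at_iff_sequentially comp_def
    proof (intro allI impI)
      fix X :: "nat \<Rightarrow> 'a"
      assume X: "\<forall>i. X i \<in> ball x e - {x}" "X \<longlonglongrightarrow> x"
      have "(\<lambda>n. \<integral>z. ?q (X n) z \<partial>N) \<longlonglongrightarrow> (\<integral>z. 0 \<partial>N)"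
      proof (rule integral_dominated_convergence)
        \<comment> \<open>One \<open>g\<close> bounds the difference quotient, the other bounds the
          gradient.\<close>
        show "integrable N (\<lambda>z. 2 * g z)" using g(1) by simp
        show "?q (X n) \<in> borel_measurable N" for n
          using X int[of "X n"] int[OF x] meas by (auto intro!: borel_measurable_divide borel_measurable_diff)
        show "AE z in N. norm (?q (X n) z) \<le> 2 * g z" for n
        proof (rule AE_I2)
          fix z assume z: "z \<in> space N"
          have "\<bar>f (X n) z - f x z\<bar> \<le> g z * norm (X n - x)" using lip[OF _ z, of "X n"] X by auto
          moreover have "\<bar>inner (X n - x) (G z)\<bar> \<le> norm (X n - x) * norm (G z)"
            by (rule Cauchy_Schwarz_ineq2)
          moreover have "norm (X n - x) * norm (G z) \<le> norm (X n - x) * g z"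
            using le[OF z] by (intro mult_left_mono) auto
          ultimately have "\<bar>f (X n) z - f x z - inner (X n - x) (G z)\<bar> \<le> 2 * (g z * norm (X n - x))"
            by (simp only: mult.commute[of "norm (X n - x)" "g z"])
          moreover have "norm (X n - x) > 0" using X by simp
          ultimately show "norm (?q (X n) z) \<le> 2 * g z" by (simp add: field_simps)
        qed
        show "AE z in N. (\<lambda>n. ?q (X n) z) \<longlonglongrightarrow> 0"
        proof (rule AE_I2)
          fix z assume "z \<in> space N"
          then have "((\<lambda>y. norm (f y z - f x z - inner (y - x) (G z)) / norm (y - x)) \<longlongrightarrow> 0) (at x)"
            using G unfolding gderiv_def has_derivative_iff_norm by blast
          moreover have "filterlim X (at x) sequentially"
            using X by (simp add: filterlim_at)
          ultimately have "(\<lambda>n. norm (?q (X n) z)) \<longlonglongrightarrow> 0"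
            by (auto dest: filterlim_compose)
          then show "(\<lambda>n. ?q (X n) z) \<longlonglongrightarrow> 0" by (rule tendsto_norm_zero_cancel)
        qed
      qed simp
      then show "(\<lambda>n. norm (\<integral>z. ?q (X n) z \<partial>N)) \<longlonglongrightarrow> 0" 
        by (intro tendsto_norm_zero) (simp only: Bochner_Integration.integral_zero)
    qed
    moreover have "norm (\<integral>z. ?q y z \<partial>N)
        = norm ((\<integral>z. f y z \<partial>N) - (\<integral>z. f x z \<partial>N) - inner (y - x) (\<integral>z. G z \<partial>N)) / norm (y - x)"
      if "y \<in> ball x e" for y
      using int[OF that] int[OF x] G_int by simp
    ultimately have "((\<lambda>y. norm ((\<integral>z. f y z \<partial>N) - (\<integral>z. f x z \<partial>N) - inner (y - x) (\<integral>z. G z \<partial>N)) / norm (y - x))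
        \<longlongrightarrow> 0) (at x within ball x e)"
      by (elim Lim_transform_within[OF _ zero_less_one]) auto
    then show "((\<lambda>y. norm ((\<integral>z. f y z \<partial>N) - (\<integral>z. f x z \<partial>N) - inner (y - x) (\<integral>z. G z \<partial>N)) / norm (y - x))
        \<longlongrightarrow> 0) (at x)"
      using e by (simp add: at_within_open[OF _ open_ball])
  qed
qed

section \<open>Marginals of the trajectory law\<close>

locale mdp_policy = mdp M
  for M :: "('s::euclidean_space, 'a::euclidean_space, 'w) mdp" +
  fixes pol :: "'s \<Rightarrow> 'a measure"
  assumes measurable_pol: "pol \<in> state_space M \<rightarrow>\<^sub>M prob_algebra (action_space M)"
begin

primrec marginal :: "('s \<times> 'a \<times> real) measure \<Rightarrow> nat \<Rightarrow> ('s \<times> 'a \<times> real) measure" where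
  "marginal \<nu> 0 = \<nu>"
| "marginal \<nu> (Suc n) = marginal \<nu> n \<bind> next_step M pol"

lemma marginal_prob_algebra:
  assumes "\<nu> \<in> space (prob_algebra (step_space M))"
  shows "marginal \<nu> n \<in> space (prob_algebra (step_space M))"
proof (induction n)
  case (Suc n)
  show ?case
    using measurable_bind_prob_space[OF measurable_const[OF Suc]
        measurable_next_step[OF measurable_pol], of "count_space UNIV"]
    by (auto dest!: measurable_space)
qed (simp add: assms)

context
  fixes \<nu> :: "('s \<times> 'a \<times> real) measure"
  assumes \<nu>: "\<nu> \<in> space (prob_algebra (step_space M))"
begin

interpretation IT: Ionescu_Tulcea "traj_kernel M pol \<nu>" "\<lambda>_. step_space M"
  by (rule Ionescu_Tulcea_traj[OF measurable_pol \<nu>])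

lemma sets_traj_law: "sets (traj_law M pol \<nu>) = sets (\<Pi>\<^sub>M i\<in>UNIV. step_space M)"
  unfolding traj_law_def by (rule IT.PF.sets_lim)

text \<open>Projecting to no coordinates at all preserves total mass, and the image is the
  probability measure that the projective family assigns to the empty index set.\<close>

lemma prob_space_traj_law: "prob_space (traj_law M pol \<nu>)"
proof -
  have "distr IT.PF.lim (PiM {} (\<lambda>_. step_space M)) (\<lambda>x. restrict x {}) = IT.CI {}"
    by (rule IT.distr_lim) simp
  then have "prob_space (distr IT.PF.lim (PiM {} (\<lambda>_. step_space M)) (\<lambda>x. restrict x {}))"
    using IT.PF.prob_space_P[of "{}"] by simp
  then show ?thesis
    unfolding traj_law_def
    by (rule prob_space_distrD[rotated])
      (simp add: measurable_cong_sets[OF IT.PF.sets_lim refl])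
qed

lemma measurable_component_traj_law: "(\<lambda>\<omega>. \<omega> n) \<in> traj_law M pol \<nu> \<rightarrow>\<^sub>M step_space M"
  unfolding measurable_cong_sets[OF sets_traj_law refl]
  by (rule measurable_component_singleton) simp

text \<open>\<open>IT.C 0 n\<close> is the law of the entries with index below \<open>n\<close>.
  Extending it draws entry \<open>n\<close> from the kernel and appends it, so reading that entry
  off returns the kernel averaged over histories.\<close>

lemma distr_C_component:
  "distr (IT.C 0 (Suc n) (\<lambda>_. undefined)) (step_space M) (\<lambda>h. h n)
     = IT.C 0 n (\<lambda>_. undefined) \<bind> traj_kernel M pol \<nu> n"
proof -
  let ?u = "\<lambda>_::nat. undefined :: 's \<times> 'a \<times> real"
  \<comment> \<open>The empty history: a product over no indices contains only the constant
    undefined function.\<close>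
  have u: "?u \<in> space (PiM {0..<0} (\<lambda>_. step_space M))" by (simp add: space_PiM)
  note ne = prob_space.not_empty[OF IT.prob_space_C[OF u]]
  have comp: "(\<lambda>h. h n) \<in> PiM {0..<Suc n} (\<lambda>_. step_space M) \<rightarrow>\<^sub>M step_space M"
    by (rule measurable_component_singleton) simp
  have eP: "IT.eP n \<in> IT.C 0 n ?u \<rightarrow>\<^sub>M subprob_algebra (PiM {0..<Suc n} (\<lambda>_. step_space M))"
    using IT.measurable_eP[of n] unfolding measurable_cong_sets[OF IT.sets_C[OF u] refl] by simp
  have "distr (IT.C 0 (Suc n) ?u) (step_space M) (\<lambda>h. h n)
      = IT.C 0 n ?u \<bind> (\<lambda>x. distr (IT.eP n x) (step_space M) (\<lambda>h. h n))"
    using distr_bind[OF eP ne comp] by simp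
  also have "\<dots> = IT.C 0 n ?u \<bind> traj_kernel M pol \<nu> n"
  proof (rule bind_cong[OF refl])
    fix x assume "x \<in> space (IT.C 0 n ?u)"
    then have x: "x \<in> space (PiM {0..<n} (\<lambda>_. step_space M))"
      by (simp add: IT.space_C[OF u])
    have upd: "fun_upd x n \<in> traj_kernel M pol \<nu> n x \<rightarrow>\<^sub>M PiM {0..<Suc n} (\<lambda>_. step_space M)"
      using x by (intro measurable_fun_upd[where J = "{0..<n}"]) (auto simp: IT.sets_P cong: measurable_cong_sets)
    have "distr (IT.eP n x) (step_space M) (\<lambda>h. h n)
        = distr (traj_kernel M pol \<nu> n x) (step_space M) (\<lambda>y. y)"
      unfolding IT.eP_def by (subst distr_distr[OF comp upd]) (simp add: comp_def)
    also have "\<dots> = traj_kernel M pol \<nu> n x"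
      by (rule distr_id2) (use IT.sets_P[OF x] in simp)
    finally show "distr (IT.eP n x) (step_space M) (\<lambda>h. h n) = traj_kernel M pol \<nu> n x" .
  qed
  finally show ?thesis .
qed

text \<open>The kernel depends on the history only through its last entry, so the law of one entry
  determines the law of the next. Integrals over trajectories thereby become integrals against
  iterated kernels.\<close>

lemma distr_traj_law: "distr (traj_law M pol \<nu>) (step_space M) (\<lambda>\<omega>. \<omega> n) = marginal \<nu> n"
proof -
  let ?u = "\<lambda>_::nat. undefined :: 's \<times> 'a \<times> real" and ?S = "\<lambda>_::nat. step_space M"
  have u: "?u \<in> space (PiM {0..<0} ?S)" by (simp add: space_PiM)
  have C: "IT.C 0 m ?u \<bind> traj_kernel M pol \<nu> m = marginal \<nu> m" for m
  proof (induction m)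
    case 0
    have "traj_kernel M pol \<nu> 0 \<in> PiM {0..<0} ?S \<rightarrow>\<^sub>M subprob_algebra (step_space M)"
      by (rule IT.P)
    from bind_return[OF this u]
    have "return (PiM {0..<0} ?S) ?u \<bind> traj_kernel M pol \<nu> 0 = traj_kernel M pol \<nu> 0 ?u" .
    also have "\<dots> = \<nu>" by (simp add: traj_kernel_def)
    finally show ?case by simp
  next
    case (Suc m)
    have comp: "(\<lambda>h. h m) \<in> IT.C 0 (Suc m) ?u \<rightarrow>\<^sub>M step_space M"
      unfolding measurable_cong_sets[OF IT.sets_C[OF u] refl]
      by (rule measurable_component_singleton) simp
    have "marginal \<nu> (Suc m)
        = distr (IT.C 0 (Suc m) ?u) (step_space M) (\<lambda>h. h m) \<bind> next_step M pol"
      using Suc distr_C_component[of m] by simp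
    also have "\<dots> = IT.C 0 (Suc m) ?u \<bind> (\<lambda>h. next_step M pol (h m))"
      by (rule bind_distr[OF comp measurable_prob_algebraD[OF measurable_next_step[OF measurable_pol]]
            prob_space.not_empty[OF IT.prob_space_C[OF u]]])
    also have "\<dots> = IT.C 0 (Suc m) ?u \<bind> traj_kernel M pol \<nu> (Suc m)"
      by (simp add: traj_kernel_def[abs_def])
    finally show ?case by (rule sym)
  qed
  \<comment> \<open>The finite-dimensional law on these indices is built from the first
    \<open>up_to\<close> entries, here exactly the entries 0 to \<open>n\<close>.\<close>
  have up: "IT.up_to {0..<Suc n} = Suc n"
    using IT.up_to_less[of "{0..<Suc n}" n] by (intro antisym) (auto simp: IT.up_to_iff)
  have comp: "(\<lambda>h. h n) \<in> PiM {0..<Suc n} ?S \<rightarrow>\<^sub>M step_space M"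
    by (rule measurable_component_singleton) simp
  have restr: "(\<lambda>h. restrict h {0..<Suc n}) \<in> traj_law M pol \<nu> \<rightarrow>\<^sub>M PiM {0..<Suc n} ?S"
    unfolding measurable_cong_sets[OF sets_traj_law refl] by (rule measurable_restrict_subset) simp
  have restr': "(\<lambda>h. restrict h {0..<Suc n}) \<in> IT.C 0 (Suc n) ?u \<rightarrow>\<^sub>M PiM {0..<Suc n} ?S"
    unfolding measurable_cong_sets[OF IT.sets_C[OF u] refl] by (rule measurable_restrict_subset) simp
  have "distr (traj_law M pol \<nu>) (step_space M) (\<lambda>\<omega>. \<omega> n)
      = distr (distr (traj_law M pol \<nu>) (PiM {0..<Suc n} ?S) (\<lambda>h. restrict h {0..<Suc n}))
          (step_space M) (\<lambda>h. h n)"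
    by (subst distr_distr[OF comp restr]) (simp add: comp_def)
  also have "\<dots> = distr (IT.CI {0..<Suc n}) (step_space M) (\<lambda>h. h n)"
    unfolding traj_law_def by (subst IT.distr_lim) auto
  also have "\<dots> = distr (IT.C 0 (Suc n) ?u) (step_space M) (\<lambda>h. h n)"
    unfolding IT.CI_def up by (subst distr_distr[OF comp restr']) (simp add: comp_def)
  also have "\<dots> = marginal \<nu> n"
    unfolding distr_C_component C ..
  finally show ?thesis .
qed

end

end

section \<open>Transition and policy operators\<close>

lemma (in prob_space) abs_expectation_le:
  fixes f :: "'a \<Rightarrow> real"
  assumes "f \<in> borel_measurable M" "\<And>x. x \<in> space M \<Longrightarrow> \<bar>f x\<bar> \<le> C"
  shows "\<bar>\<integral>x. f x \<partial>M\<bar> \<le> C"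
proof -
  have "integrable M f"
    using assms by (intro integrable_const_bound[of _ C]) auto
  then have "(\<integral>x. \<bar>f x\<bar> \<partial>M) \<le> (\<integral>x. C \<partial>M)"
    using assms(2) by (intro integral_mono) auto
  moreover have "(\<integral>x. C \<partial>M) = C" by (simp add: prob_space)
  ultimately show ?thesis
    using integral_abs_bound[of M f] by linarith
qed

text \<open>The bound is only almost sure because the space of trajectories contains arbitrary real
  rewards, among them values that the reward laws never produce. Geometric decay then justifies the
  exchange.\<close>

lemma (in prob_space) integral_geometric_suminf:
  fixes f :: "nat \<Rightarrow> 'a \<Rightarrow> real"
  assumes f: "\<And>t. f t \<in> borel_measurable M" "AE x in M. \<forall>t. \<bar>f t x\<bar> \<le> C"
    and \<gamma>: "0 \<le> \<gamma>" "\<gamma> < 1"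
  shows "(\<integral>x. (\<Sum>t. \<gamma> ^ t * f t x) \<partial>M) = (\<Sum>t. \<gamma> ^ t * (\<integral>x. f t x \<partial>M))"
proof -
  have geo: "summable (\<lambda>t. \<gamma> ^ t * C)"
    using \<gamma> by (intro summable_mult2 summable_geometric) auto
  have AE_f: "AE x in M. \<bar>f t x\<bar> \<le> C" for t
    using f(2) by eventually_elim auto
  have int: "integrable M (f t)" for t
    using f(1) AE_f by (intro integrable_const_bound[of _ C]) auto
  have "(\<integral>x. \<bar>f t x\<bar> \<partial>M) \<le> C" for t
    using integral_mono_AE[of M "\<lambda>x. \<bar>f t x\<bar>" "\<lambda>_. C"] int AE_f by (simp add: prob_space)
  then have "norm (\<integral>x. norm (\<gamma> ^ t * f t x) \<partial>M) \<le> \<gamma> ^ t * C" for t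
    using \<gamma> by (simp add: abs_mult mult_left_mono)
  then have "summable (\<lambda>t. \<integral>x. norm (\<gamma> ^ t * f t x) \<partial>M)"
    by (intro summable_comparison_test'[OF geo])
  moreover have "AE x in M. summable (\<lambda>t. norm (\<gamma> ^ t * f t x))"
    using f(2)
  proof eventually_elim
    case (elim x)
    then show ?case
      using \<gamma> by (intro summable_comparison_test'[OF geo]) (auto simp: abs_mult intro!: mult_left_mono)
  qed
  ultimately have "(\<integral>x. (\<Sum>t. \<gamma> ^ t * f t x) \<partial>M) = (\<Sum>t. \<integral>x. \<gamma> ^ t * f t x \<partial>M)"
    using int by (intro integral_suminf) auto
  then show ?thesis by simp
qed

lemma abs_suminf_geometric_le:
  fixes f :: "nat \<Rightarrow> real"
  assumes "\<And>t. \<bar>f t\<bar> \<le> C" "0 \<le> \<gamma>" "\<gamma> < 1"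
  shows "summable (\<lambda>t. \<gamma> ^ t * f t)" "\<bar>\<Sum>t. \<gamma> ^ t * f t\<bar> \<le> C / (1 - \<gamma>)"
proof -
  have geo: "(\<lambda>t. \<gamma> ^ t * C) sums (C / (1 - \<gamma>))"
    using sums_mult2[OF geometric_sums[of \<gamma>], of C] assms by simp
  have le: "norm (\<gamma> ^ t * f t) \<le> \<gamma> ^ t * C" for t
    using assms by (auto simp: abs_mult intro!: mult_left_mono)
  show "summable (\<lambda>t. \<gamma> ^ t * f t)"
    by (rule summable_comparison_test'[OF sums_summable[OF geo]]) (rule le)
  show "\<bar>\<Sum>t. \<gamma> ^ t * f t\<bar> \<le> C / (1 - \<gamma>)"
    using norm_suminf_le[OF le sums_summable[OF geo]] sums_unique[OF geo] by simp
qed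

lemma integral_bind_prob_algebra:
  fixes f :: "'b \<Rightarrow> real"
  assumes \<mu>: "\<mu> \<in> space (prob_algebra N)" and K: "K \<in> N \<rightarrow>\<^sub>M prob_algebra R"
    and f: "f \<in> borel_measurable R" "\<And>x. x \<in> space R \<Longrightarrow> \<bar>f x\<bar> \<le> C"
  shows "(\<integral>x. f x \<partial>(\<mu> \<bind> K)) = (\<integral>y. (\<integral>x. f x \<partial>K y) \<partial>\<mu>)"
proof (rule integral_bind[OF f, where B' = 1])
  have sets: "sets \<mu> = sets N" and "prob_space \<mu>"
    using \<mu> by (auto simp: space_prob_algebra)
  show "K \<in> \<mu> \<rightarrow>\<^sub>M subprob_algebra R"
    unfolding measurable_cong_sets[OF sets refl] by (rule measurable_prob_algebraD[OF K])
  show "finite_measure \<mu>"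
    using \<open>prob_space \<mu>\<close> by (simp add: prob_space_def)
  show "AE x in \<mu>. emeasure (K x) (space (K x)) \<le> ennreal 1"
    using measurable_space[OF K] sets_eq_imp_space_eq[OF sets]
    by (intro AE_I2) (auto simp: space_prob_algebra prob_space.emeasure_space_1)
qed auto

lemma measurable_integral_prob_algebra:
  fixes f :: "'b \<Rightarrow> real"
  assumes "K \<in> N \<rightarrow>\<^sub>M prob_algebra R" "f \<in> borel_measurable R"
  shows "(\<lambda>y. \<integral>x. f x \<partial>K y) \<in> borel_measurable N"
  using measurable_compose[OF measurable_prob_algebraD[OF assms(1)] integral_measurable_subprob_algebra[OF assms(2)]] .

lemma abs_integral_prob_algebra_le:
  fixes f :: "'b \<Rightarrow> real"
  assumes "\<mu> \<in> space (prob_algebra N)" "f \<in> borel_measurable N" "\<And>x. x \<in> space N \<Longrightarrow> \<bar>f x\<bar> \<le> C"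
  shows "\<bar>\<integral>x. f x \<partial>\<mu>\<bar> \<le> C"
proof -
  have sets: "sets \<mu> = sets N" and "prob_space \<mu>"
    using assms(1) by (auto simp: space_prob_algebra)
  then show ?thesis
    using assms(2,3) sets_eq_imp_space_eq[OF sets]
    by (intro prob_space.abs_expectation_le) (auto simp: measurable_cong_sets[OF sets refl])
qed

lemma integrable_prob_algebra:
  fixes f :: "'b \<Rightarrow> real"
  assumes "\<mu> \<in> space (prob_algebra N)" "f \<in> borel_measurable N" "\<And>x. x \<in> space N \<Longrightarrow> \<bar>f x\<bar> \<le> C"
  shows "integrable \<mu> f"
proof -
  have sets: "sets \<mu> = sets N" and "prob_space \<mu>"
    using assms(1) by (auto simp: space_prob_algebra)
  then interpret prob_space \<mu> by simp
  show ?thesis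
    using assms(2,3) sets_eq_imp_space_eq[OF sets]
    by (intro integrable_const_bound[of _ C]) (auto simp: measurable_cong_sets[OF sets refl])
qed

section \<open>The transition operator\<close>

context mdp
begin

lemma space_step_space: "space (step_space M) = states M \<times> actions M \<times> UNIV"
  by (simp add: step_space_def space_pair_measure space_state_space space_action_space)

lemma trans_kernel_prob_algebra:
  "\<lbrakk>s \<in> states M; a \<in> actions M\<rbrakk> \<Longrightarrow> trans_kernel M s a \<in> space (prob_algebra (state_space M))"
  using measurable_space[OF measurable_trans_kernel, of "(s, a)"]
  by (simp add: space_state_space space_action_space space_pair_measure)

lemma reward_kernel_prob_algebra:
  "\<lbrakk>s \<in> states M; a \<in> actions M\<rbrakk> \<Longrightarrow> reward_kernel M s a \<in> space (prob_algebra borel)"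
  using measurable_space[OF measurable_reward_kernel, of "(s, a)"]
  by (simp add: space_state_space space_action_space space_pair_measure)

text \<open>The transition operator T on state functions is \<open>policy_op (trans_op f)\<close>.
  Splitting it in two leaves the action visible between the halves, where it is
  differentiated.\<close>

definition trans_op :: "('s \<Rightarrow> real) \<Rightarrow> 's \<Rightarrow> 'a \<Rightarrow> real" where
  "trans_op f s a = (\<integral>s'. f s' \<partial>trans_kernel M s a)"

text \<open>The bound is an explicit parameter because the size of the difference of two value
  functions has to be tracked through every operator.\<close>

definition bounded_state_fun :: "real \<Rightarrow> ('s \<Rightarrow> real) \<Rightarrow> bool" where
  "bounded_state_fun C f \<longleftrightarrow> f \<in> borel_measurable (state_space M) \<and> (\<forall>s\<in>states M. \<bar>f s\<bar> \<le> C)"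

definition bounded_action_fun :: "real \<Rightarrow> ('s \<Rightarrow> 'a \<Rightarrow> real) \<Rightarrow> bool" where
  "bounded_action_fun C h \<longleftrightarrow> (\<lambda>(s, a). h s a) \<in> borel_measurable (state_space M \<Otimes>\<^sub>M action_space M)
     \<and> (\<forall>s\<in>states M. \<forall>a\<in>actions M. \<bar>h s a\<bar> \<le> C)"

lemma integral_step_at:
  fixes F :: "'s \<times> 'a \<times> real \<Rightarrow> real"
  assumes "s \<in> states M" "a \<in> actions M" and F: "F \<in> borel_measurable (step_space M)"
  shows "(\<integral>x. F x \<partial>step_at M s a) = (\<integral>r. F (s, a, r) \<partial>reward_kernel M s a)"
  unfolding step_at_def
proof (rule integral_distr[OF _ F])
  have "sets (reward_kernel M s a) = sets borel"
    using reward_kernel_prob_algebra[OF assms(1,2)] by (simp add: space_prob_algebra)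
  then show "(\<lambda>r. (s, a, r)) \<in> reward_kernel M s a \<rightarrow>\<^sub>M step_space M"
    using assms(1,2) unfolding step_space_def
    by (auto simp: space_state_space space_action_space cong: measurable_cong_sets
        intro!: measurable_Pair)
qed

lemma bounded_trans_op:
  assumes f: "bounded_state_fun C f"
  shows "bounded_action_fun C (trans_op f)"
proof -
  have "(\<lambda>z. \<integral>x. f x \<partial>(case z of (s, a) \<Rightarrow> trans_kernel M s a))
      \<in> borel_measurable (state_space M \<Otimes>\<^sub>M action_space M)"
    using f by (intro measurable_integral_prob_algebra[OF measurable_trans_kernel])
      (simp add: bounded_state_fun_def)
  then show ?thesis
    using f abs_integral_prob_algebra_le[OF trans_kernel_prob_algebra, of _ _ f C]
    by (auto simp: bounded_action_fun_def trans_op_def split_beta' bounded_state_fun_def space_state_space)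
qed

lemma measurable_lift_action_fun:
  assumes "(\<lambda>(s, a). h s a) \<in> borel_measurable (state_space M \<Otimes>\<^sub>M action_space M)"
  shows "(\<lambda>(s, a, r). h s a) \<in> borel_measurable (step_space M)"
proof -
  have "(\<lambda>x. (fst x, fst (snd x))) \<in> step_space M \<rightarrow>\<^sub>M state_space M \<Otimes>\<^sub>M action_space M"
    unfolding step_space_def by measurable
  from measurable_compose[OF this assms] show ?thesis by (simp add: split_beta')
qed

lemma trans_op_cong:
  assumes "s \<in> states M" "a \<in> actions M" "\<And>s'. s' \<in> states M \<Longrightarrow> f s' = g s'"
  shows "trans_op f s a = trans_op g s a"
  unfolding trans_op_def
  using trans_kernel_prob_algebra[OF assms(1,2)] assms(3)
    sets_eq_imp_space_eq[of "trans_kernel M s a" "state_space M"]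
  by (intro Bochner_Integration.integral_cong) (auto simp: space_prob_algebra space_state_space)

text \<open>The finite volume of the compact state set makes constants integrable, so that they can
  serve as dominating functions for state integrals.\<close>

lemma finite_measure_state_space: "finite_measure (state_space M)"
proof
  have "emeasure (state_space M) (space (state_space M)) = emeasure lborel (states M)"
    unfolding space_state_space unfolding state_space_def
    using compact_states by (intro emeasure_restrict_space) (auto intro: borel_compact)
  then show "emeasure (state_space M) (space (state_space M)) \<noteq> \<infinity>"
    using emeasure_compact_finite[OF compact_states] by simp
qed

lemma measurable_trans_density:
  assumes "s \<in> states M" "a \<in> actions M"
  shows "(\<lambda>s'. trans_density M s' s a) \<in> borel_measurable (state_space M)"
proof -
  have "(s, a) \<in> space (state_space M \<Otimes>\<^sub>M action_space M)"
    using assms by (simp add: space_pair_measure space_state_space space_action_space)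
  from measurable_compose[OF measurable_Pair1'[OF this] measurable_trans]
  show ?thesis by simp
qed

text \<open>Trades a measure that varies with the action for a fixed one, as differentiation under
  the integral requires.\<close>

lemma trans_op_density:
  assumes s: "s \<in> states M" "a \<in> actions M" and f: "f \<in> borel_measurable (state_space M)"
  shows "trans_op f s a = (\<integral>s'. trans_density M s' s a * f s' \<partial>state_space M)"
  unfolding trans_op_def trans_kernel_def
  using s by (intro integral_real_density f measurable_trans_density AE_I2 trans_nonneg)
    (auto simp: space_state_space)

end

section \<open>The policy operator and its iteration along trajectories\<close>

context mdp_policy
begin

lemma pol_prob_algebra: "s \<in> states M \<Longrightarrow> pol s \<in> space (prob_algebra (action_space M))"
  using measurable_space[OF measurable_pol] by (simp add: space_state_space)

lemma step_from_prob_algebra: "s \<in> states M \<Longrightarrow> step_from M pol s \<in> space (prob_algebra (step_space M))"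
  using measurable_space[OF measurable_step_from[OF measurable_pol]] by (simp add: space_state_space)

definition policy_op :: "('s \<Rightarrow> 'a \<Rightarrow> real) \<Rightarrow> 's \<Rightarrow> real" where
  "policy_op h s = (\<integral>a. h s a \<partial>pol s)"

lemma integral_step_from:
  fixes F :: "'s \<times> 'a \<times> real \<Rightarrow> real"
  assumes s: "s \<in> states M" and F: "F \<in> borel_measurable (step_space M)"
    and C: "\<And>x. x \<in> space (step_space M) \<Longrightarrow> \<bar>F x\<bar> \<le> C"
  shows "(\<integral>x. F x \<partial>step_from M pol s) = (\<integral>a. (\<integral>r. F (s, a, r) \<partial>reward_kernel M s a) \<partial>pol s)"
proof -
  have "step_at M s \<in> action_space M \<rightarrow>\<^sub>M prob_algebra (step_space M)"
    using measurable_compose[OF measurable_Pair1'[of s "state_space M"] measurable_step_at] s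
    by (simp add: space_state_space)
  then have "(\<integral>x. F x \<partial>step_from M pol s) = (\<integral>a. (\<integral>x. F x \<partial>step_at M s a) \<partial>pol s)"
    unfolding step_from_def using pol_prob_algebra[OF s] F C
    by (intro integral_bind_prob_algebra) auto
  also have "\<dots> = (\<integral>a. (\<integral>r. F (s, a, r) \<partial>reward_kernel M s a) \<partial>pol s)"
    using pol_prob_algebra[OF s] sets_eq_imp_space_eq[of "pol s" "action_space M"]
    by (intro Bochner_Integration.integral_cong integral_step_at[OF s _ F])
      (auto simp: space_prob_algebra space_action_space)
  finally show ?thesis .
qed

lemma integral_lift_step_from:
  assumes s: "s \<in> states M" and h: "bounded_action_fun C h"
  shows "(\<integral>x. (case x of (s, a, r) \<Rightarrow> h s a) \<partial>step_from M pol s) = policy_op h s"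
proof -
  have "(\<integral>x. (case x of (s, a, r) \<Rightarrow> h s a) \<partial>step_from M pol s)
      = (\<integral>a. (\<integral>r. h s a \<partial>reward_kernel M s a) \<partial>pol s)"
    using h measurable_lift_action_fun[of h]
    by (subst integral_step_from[OF s, where C = C])
      (auto simp: bounded_action_fun_def space_step_space)
  also have "\<dots> = policy_op h s"
    unfolding policy_op_def
    using pol_prob_algebra[OF s] sets_eq_imp_space_eq[of "pol s" "action_space M"]
      reward_kernel_prob_algebra[OF s]
    by (intro Bochner_Integration.integral_cong)
      (auto simp: space_prob_algebra space_action_space prob_space.prob_space)
  finally show ?thesis .
qed

text \<open>In \<open>policy_op h s\<close> integrand and measure both vary with the state. Written
  as the integral of one fixed function against the kernel \<open>step_from\<close>, it is
  measurable in the state.\<close>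

lemma bounded_policy_op:
  assumes h: "bounded_action_fun C h"
  shows "bounded_state_fun C (policy_op h)"
proof -
  let ?F = "\<lambda>x. case x of (s, a, r) \<Rightarrow> h s a"
  have F: "?F \<in> borel_measurable (step_space M)"
    using h measurable_lift_action_fun[of h] by (simp add: bounded_action_fun_def)
  have "(\<lambda>s. \<integral>x. ?F x \<partial>step_from M pol s) \<in> borel_measurable (state_space M)"
    by (rule measurable_integral_prob_algebra[OF measurable_step_from[OF measurable_pol] F])
  then have "policy_op h \<in> borel_measurable (state_space M)"
    by (rule measurable_cong[THEN iffD1, rotated])
      (simp add: integral_lift_step_from[OF _ h] space_state_space)
  moreover have "\<bar>policy_op h s\<bar> \<le> C" if "s \<in> states M" for s
    using h abs_integral_prob_algebra_le[OF step_from_prob_algebra[OF that] F, of C]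
    by (auto simp: integral_lift_step_from[OF that h] bounded_action_fun_def space_step_space)
  ultimately show ?thesis by (simp add: bounded_state_fun_def)
qed

lemma integral_next_step:
  fixes F :: "'s \<times> 'a \<times> real \<Rightarrow> real"
  assumes "s \<in> states M" "a \<in> actions M" and F: "F \<in> borel_measurable (step_space M)"
    and C: "\<And>x. x \<in> space (step_space M) \<Longrightarrow> \<bar>F x\<bar> \<le> C"
  shows "(\<integral>x. F x \<partial>next_step M pol (s, a, r)) = trans_op (\<lambda>s'. \<integral>x. F x \<partial>step_from M pol s') s a"
  unfolding next_step_def trans_op_def prod.case
  by (rule integral_bind_prob_algebra[OF trans_kernel_prob_algebra[OF assms(1,2)]
        measurable_step_from[OF measurable_pol] F C])

lemma integral_marginal_Suc:
  fixes F :: "'s \<times> 'a \<times> real \<Rightarrow> real"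
  assumes \<nu>: "\<nu> \<in> space (prob_algebra (step_space M))" and F: "F \<in> borel_measurable (step_space M)"
    and C: "\<And>x. x \<in> space (step_space M) \<Longrightarrow> \<bar>F x\<bar> \<le> C"
  shows "(\<integral>x. F x \<partial>marginal \<nu> (Suc n))
     = (\<integral>x. (case x of (s, a, r) \<Rightarrow> trans_op (\<lambda>s'. \<integral>x. F x \<partial>step_from M pol s') s a) \<partial>marginal \<nu> n)"
proof -
  have "space (marginal \<nu> n) = states M \<times> actions M \<times> UNIV"
    using marginal_prob_algebra[OF \<nu>, of n] sets_eq_imp_space_eq[of "marginal \<nu> n" "step_space M"]
    by (simp add: space_prob_algebra space_step_space)
  then show ?thesis
    unfolding marginal.simps
    by (subst integral_bind_prob_algebra[OF marginal_prob_algebra[OF \<nu>] measurable_next_step[OF measurable_pol] F C])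
      (auto intro!: Bochner_Integration.integral_cong simp: integral_next_step[OF _ _ F C])
qed

text \<open>Time steps are moved from the law of the triple onto the integrand. Rewards do not
  influence the next step, so functions of state and action are closed under this.\<close>

lemma integral_lift_marginal:
  assumes \<nu>: "\<nu> \<in> space (prob_algebra (step_space M))" and h: "bounded_action_fun C h"
  shows "(\<integral>x. (case x of (s, a, r) \<Rightarrow> h s a) \<partial>marginal \<nu> n)
     = (\<integral>x. (case x of (s, a, r) \<Rightarrow> ((\<lambda>h. trans_op (policy_op h)) ^^ n) h s a) \<partial>\<nu>)"
  using h
proof (induction n arbitrary: h)
  case (Suc n)
  have sp: "space (marginal \<nu> n) = states M \<times> actions M \<times> UNIV"
    using marginal_prob_algebra[OF \<nu>, of n] sets_eq_imp_space_eq[of "marginal \<nu> n" "step_space M"]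
    by (simp add: space_prob_algebra space_step_space)
  have "(\<integral>x. (case x of (s, a, r) \<Rightarrow> h s a) \<partial>marginal \<nu> (Suc n))
      = (\<integral>x. (case x of (s, a, r) \<Rightarrow> trans_op (\<lambda>s'. \<integral>x. (case x of (s, a, r) \<Rightarrow> h s a) \<partial>step_from M pol s') s a)
          \<partial>marginal \<nu> n)"
    using Suc.prems measurable_lift_action_fun[of h]
    by (intro integral_marginal_Suc[OF \<nu>, where C = C]) (auto simp: bounded_action_fun_def space_step_space)
  also have "\<dots> = (\<integral>x. (case x of (s, a, r) \<Rightarrow> trans_op (policy_op h) s a) \<partial>marginal \<nu> n)"
    unfolding trans_op_def
    using trans_kernel_prob_algebra sets_eq_imp_space_eq[of _ "state_space M"]
    by (intro Bochner_Integration.integral_cong)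
      (auto simp: sp space_prob_algebra space_state_space integral_lift_step_from[OF _ Suc.prems]
        intro!: Bochner_Integration.integral_cong)
  \<comment> \<open>The step peeled off is the last one in time, hence the innermost factor of the
    iterate; this is why \<open>h\<close> varies in the induction.\<close>
  also have "\<dots> = (\<integral>x. (case x of (s, a, r) \<Rightarrow> ((\<lambda>h. trans_op (policy_op h)) ^^ n) (trans_op (policy_op h)) s a) \<partial>\<nu>)"
    by (rule Suc.IH[OF bounded_trans_op[OF bounded_policy_op[OF Suc.prems]]])
  finally show ?case by (simp only: funpow_Suc_right comp_def)
qed simp

end

section \<open>The Bellman equation\<close>

lemma AE_bind_prob_algebra:
  assumes "\<mu> \<in> space (prob_algebra N)" "K \<in> N \<rightarrow>\<^sub>M prob_algebra R" "Measurable.pred R P"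
    and "\<And>x. x \<in> space N \<Longrightarrow> AE y in K x. P y"
  shows "AE y in \<mu> \<bind> K. P y"
proof -
  have sets: "sets \<mu> = sets N" using assms(1) by (simp add: space_prob_algebra)
  have "K \<in> \<mu> \<rightarrow>\<^sub>M subprob_algebra R"
    unfolding measurable_cong_sets[OF sets refl] by (rule measurable_prob_algebraD[OF assms(2)])
  then show ?thesis
    using assms(3,4) sets_eq_imp_space_eq[OF sets] by (subst AE_bind) auto
qed

text \<open>The theory of the value functions asks only for a measurable utility that is bounded
  where rewards can lie; derivatives enter later.\<close>

locale bounded_utility_mdp = mdp_policy M pol
  for M :: "('s::euclidean_space, 'a::euclidean_space, 'w) mdp" and pol +
  fixes \<psi> :: "real \<Rightarrow> real" and B C :: real
  assumes measurable_utility: "\<psi> \<in> borel_measurable borel"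
    and reward_le: "\<lbrakk>s \<in> states M; a \<in> actions M; w \<in> space (noise M)\<rbrakk> \<Longrightarrow> \<bar>reward M s a w\<bar> \<le> B"
    and utility_le: "\<bar>x\<bar> \<le> B \<Longrightarrow> \<bar>\<psi> x\<bar> \<le> C"
    and C_nonneg: "0 \<le> C"
begin

definition expected_utility :: "'s \<Rightarrow> 'a \<Rightarrow> real" where
  "expected_utility s a = (\<integral>w. \<psi> (reward M s a w) \<partial>noise M)"

text \<open>\<open>\<psi>\<close> may be unbounded, while the space of steps admits every real
  reward. The clipped version is bounded everywhere and agrees with \<open>\<psi>\<close> almost
  surely, so results on bounded integrands apply to it.\<close>

definition clipped_utility :: "real \<Rightarrow> real" where
  "clipped_utility r = (if \<bar>r\<bar> \<le> B then \<psi> r else 0)"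

lemma clipped_utility_le: "\<bar>clipped_utility r\<bar> \<le> C"
  using utility_le C_nonneg by (simp add: clipped_utility_def)

lemma measurable_clipped_utility: "clipped_utility \<in> borel_measurable borel"
  unfolding clipped_utility_def[abs_def] using measurable_utility by measurable

lemma measurable_reward_noise:
  assumes "s \<in> states M" "a \<in> actions M"
  shows "reward M s a \<in> borel_measurable (noise M)"
proof -
  have "(s, a) \<in> space (state_space M \<Otimes>\<^sub>M action_space M)"
    using assms by (simp add: space_pair_measure space_state_space space_action_space)
  from measurable_compose[OF measurable_Pair1'[OF this] measurable_reward]
  show ?thesis by simp
qed

lemma integral_clipped_utility:
  assumes "s \<in> states M" "a \<in> actions M"
  shows "(\<integral>r. clipped_utility r \<partial>reward_kernel M s a) = expected_utility s a"
  unfolding reward_kernel[OF assms] expected_utility_def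
  by (subst integral_distr[OF measurable_reward_noise[OF assms] measurable_clipped_utility])
    (auto intro!: Bochner_Integration.integral_cong simp: clipped_utility_def reward_le[OF assms])

lemma measurable_clipped_reward:
  "(\<lambda>x. clipped_utility (snd (snd x))) \<in> borel_measurable (step_space M)"
  unfolding step_space_def using measurable_clipped_utility by measurable

lemma measurable_utility_reward:
  "(\<lambda>x. \<psi> (snd (snd x))) \<in> borel_measurable (step_space M)"
  unfolding step_space_def using measurable_utility by measurable

lemma bounded_expected_utility: "bounded_action_fun C expected_utility"
proof -
  have "(\<lambda>z. \<integral>r. clipped_utility r \<partial>(case z of (s, a) \<Rightarrow> reward_kernel M s a))
      \<in> borel_measurable (state_space M \<Otimes>\<^sub>M action_space M)"
    by (rule measurable_integral_prob_algebra[OF measurable_reward_kernel measurable_clipped_utility])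
  then have "(\<lambda>(s, a). expected_utility s a) \<in> borel_measurable (state_space M \<Otimes>\<^sub>M action_space M)"
    by (rule measurable_cong[THEN iffD1, rotated])
      (auto simp: space_pair_measure space_state_space space_action_space integral_clipped_utility)
  moreover have "\<bar>expected_utility s a\<bar> \<le> C" if "s \<in> states M" "a \<in> actions M" for s a
    using abs_integral_prob_algebra_le[OF reward_kernel_prob_algebra[OF that] measurable_clipped_utility
        clipped_utility_le]
    by (simp add: integral_clipped_utility[OF that])
  ultimately show ?thesis by (simp add: bounded_action_fun_def)
qed

lemma pred_reward_le: "Measurable.pred (step_space M) (\<lambda>x. \<bar>snd (snd x)\<bar> \<le> B)"
  unfolding step_space_def by measurable

lemma AE_step_at:
  assumes "s \<in> states M" "a \<in> actions M"
  shows "AE x in step_at M s a. \<bar>snd (snd x)\<bar> \<le> B"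
proof -
  have "(\<lambda>r. (s, a, r)) \<in> reward_kernel M s a \<rightarrow>\<^sub>M step_space M"
    using assms reward_kernel[OF assms] unfolding step_space_def
    by (auto simp: space_state_space space_action_space intro!: measurable_Pair)
  moreover have "AE r in reward_kernel M s a. \<bar>r\<bar> \<le> B"
    unfolding reward_kernel[OF assms]
    by (subst AE_distr_iff[OF measurable_reward_noise[OF assms]]) (auto simp: reward_le[OF assms])
  ultimately show ?thesis
    unfolding step_at_def using pred_reward_le by (subst AE_distr_iff) (auto simp: pred_def)
qed

lemma AE_step_from:
  assumes s: "s \<in> states M"
  shows "AE x in step_from M pol s. \<bar>snd (snd x)\<bar> \<le> B"
  unfolding step_from_def
proof (rule AE_bind_prob_algebra[OF pol_prob_algebra[OF s] _ pred_reward_le])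
  show "step_at M s \<in> action_space M \<rightarrow>\<^sub>M prob_algebra (step_space M)"
    using measurable_compose[OF measurable_Pair1'[of s "state_space M"] measurable_step_at] s
    by (simp add: space_state_space)
qed (simp add: AE_step_at[OF s] space_action_space)

text \<open>Every step after the first draws a fresh reward, so the bound comes from the reward law
  whatever the preceding triple was; no induction on time is involved.\<close>

lemma AE_marginal:
  assumes \<nu>: "\<nu> \<in> space (prob_algebra (step_space M))" "AE x in \<nu>. \<bar>snd (snd x)\<bar> \<le> B"
  shows "AE x in marginal \<nu> n. \<bar>snd (snd x)\<bar> \<le> B"
proof (cases n)
  case (Suc m)
  have "AE x in next_step M pol y. \<bar>snd (snd x)\<bar> \<le> B" if y: "y \<in> space (step_space M)" for y
  proof -
    obtain s a r where y: "y = (s, a, r)" "s \<in> states M" "a \<in> actions M"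
      using y by (auto simp: space_step_space)
    show ?thesis
      unfolding y(1) next_step_def prod.case
      using AE_step_from
      by (intro AE_bind_prob_algebra[OF trans_kernel_prob_algebra[OF y(2,3)]
            measurable_step_from[OF measurable_pol] pred_reward_le]) (simp add: space_state_space)
  qed
  then show ?thesis
    unfolding Suc marginal.simps
    by (rule AE_bind_prob_algebra[OF marginal_prob_algebra[OF \<nu>(1)] measurable_next_step[OF measurable_pol]
          pred_reward_le])
next
  case 0
  show ?thesis unfolding 0 marginal.simps by (rule \<nu>(2))
qed

text \<open>The mean utility at time \<open>t\<close>. The iterated operator is the state-action
  analogue of T, with the two halves in the opposite order.\<close>

abbreviation expected_reward_after :: "nat \<Rightarrow> 's \<Rightarrow> 'a \<Rightarrow> real" where
  "expected_reward_after t \<equiv> ((\<lambda>h. trans_op (policy_op h)) ^^ t) expected_utility"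

lemma bounded_expected_reward_after: "bounded_action_fun C (expected_reward_after t)"
  by (induction t) (auto intro: bounded_trans_op bounded_policy_op bounded_expected_utility)

text \<open>Given state and action, the reward is drawn last and can be averaged out first. Time 0
  is separate because its state and action are prescribed instead of drawn.\<close>

lemma integral_clipped_reward_marginal:
  assumes s: "s \<in> states M" "a \<in> actions M"
  shows "(\<integral>x. clipped_utility (snd (snd x)) \<partial>marginal (step_at M s a) t)
      = (\<integral>x. (case x of (s, a, r) \<Rightarrow> expected_utility s a) \<partial>marginal (step_at M s a) t)"
proof (cases t)
  case 0
  have "prob_space (reward_kernel M s a)"
    using reward_kernel_prob_algebra[OF s] by (simp add: space_prob_algebra)
  then show ?thesis
    using 0 measurable_lift_action_fun[of expected_utility] bounded_expected_utility
    by (simp add: integral_step_at[OF s] measurable_clipped_reward integral_clipped_utility[OF s]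
        bounded_action_fun_def prob_space.prob_space)
next
  case (Suc n)
  have lift: "(\<lambda>(s, a, r). expected_utility s a) \<in> borel_measurable (step_space M)"
    using measurable_lift_action_fun bounded_expected_utility by (auto simp: bounded_action_fun_def)
  have bd: "\<bar>(case x of (s, a, r) \<Rightarrow> expected_utility s a)\<bar> \<le> C" if "x \<in> space (step_space M)" for x
    using that bounded_expected_utility by (auto simp: bounded_action_fun_def space_step_space)
  have eq: "(\<integral>x. clipped_utility (snd (snd x)) \<partial>step_from M pol s')
      = (\<integral>x. (case x of (s, a, r) \<Rightarrow> expected_utility s a) \<partial>step_from M pol s')" if s': "s' \<in> states M" for s'
    unfolding integral_lift_step_from[OF s' bounded_expected_utility]
    unfolding integral_step_from[OF s' measurable_clipped_reward clipped_utility_le] policy_op_def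
    using pol_prob_algebra[OF s'] sets_eq_imp_space_eq[of "pol s'" "action_space M"]
    by (intro Bochner_Integration.integral_cong)
      (auto simp: space_prob_algebra space_action_space integral_clipped_utility[OF s'])
  have sp: "space (marginal (step_at M s a) n) = states M \<times> actions M \<times> UNIV"
    using marginal_prob_algebra[OF step_at_prob_algebra[OF s], of n]
      sets_eq_imp_space_eq[of "marginal (step_at M s a) n" "step_space M"]
    by (simp add: space_prob_algebra space_step_space)
  have "(\<integral>x. clipped_utility (snd (snd x)) \<partial>marginal (step_at M s a) (Suc n))
      = (\<integral>x. (case x of (s, a, r) \<Rightarrow>
          trans_op (\<lambda>s'. \<integral>x. clipped_utility (snd (snd x)) \<partial>step_from M pol s') s a) \<partial>marginal (step_at M s a) n)"
    by (rule integral_marginal_Suc[OF step_at_prob_algebra[OF s] measurable_clipped_reward clipped_utility_le])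
  also have "\<dots> = (\<integral>x. (case x of (s, a, r) \<Rightarrow>
      trans_op (\<lambda>s'. \<integral>x. (case x of (s, a, r) \<Rightarrow> expected_utility s a) \<partial>step_from M pol s') s a)
        \<partial>marginal (step_at M s a) n)"
    by (intro Bochner_Integration.integral_cong) (auto simp: sp eq intro!: trans_op_cong)
  also have "\<dots> = (\<integral>x. (case x of (s, a, r) \<Rightarrow> expected_utility s a) \<partial>marginal (step_at M s a) (Suc n))"
    by (rule integral_marginal_Suc[OF step_at_prob_algebra[OF s] lift bd, symmetric])
  finally show ?thesis unfolding Suc .
qed

text \<open>The passage from trajectories to operators: after sum and expectation are exchanged,
  each term involves a single marginal, and duality moves all its time steps onto the
  utility.\<close>

lemma Q_value_suminf:
  assumes s: "s \<in> states M" "a \<in> actions M"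
  shows "Q_value M pol \<psi> s a = (\<Sum>t. discount M ^ t * expected_reward_after t s a)"
proof -
  let ?\<nu> = "step_at M s a" and ?L = "traj_law M pol (step_at M s a)"
  note \<nu> = step_at_prob_algebra[OF s]
  interpret L: prob_space ?L by (rule prob_space_traj_law[OF \<nu>])
  note comp = measurable_component_traj_law[OF \<nu>]
  have meas: "(\<lambda>\<omega>. \<psi> (snd (snd (\<omega> t)))) \<in> borel_measurable ?L" for t
    using measurable_compose[OF comp measurable_utility_reward] .
  have AE_m: "AE x in marginal ?\<nu> t. \<bar>snd (snd x)\<bar> \<le> B" for t
    by (rule AE_marginal[OF \<nu> AE_step_at[OF s]])
  have "AE \<omega> in ?L. \<bar>\<psi> (snd (snd (\<omega> t)))\<bar> \<le> C" for t
  proof -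
    have "AE x in distr ?L (step_space M) (\<lambda>\<omega>. \<omega> t). \<bar>snd (snd x)\<bar> \<le> B"
      unfolding distr_traj_law[OF \<nu>] by (rule AE_m)
    then have "AE \<omega> in ?L. \<bar>snd (snd (\<omega> t))\<bar> \<le> B"
      using pred_reward_le by (subst (asm) AE_distr_iff[OF comp]) (auto simp: pred_def)
    then show ?thesis by eventually_elim (rule utility_le)
  qed
  then have "AE \<omega> in ?L. \<forall>t. \<bar>\<psi> (snd (snd (\<omega> t)))\<bar> \<le> C"
    by (simp add: AE_all_countable)
  then have "Q_value M pol \<psi> s a = (\<Sum>t. discount M ^ t * (\<integral>\<omega>. \<psi> (snd (snd (\<omega> t))) \<partial>?L))"
    unfolding Q_value_def using discount by (intro L.integral_geometric_suminf[OF meas]) auto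
  moreover have "(\<integral>\<omega>. \<psi> (snd (snd (\<omega> t))) \<partial>?L) = expected_reward_after t s a" for t
  proof -
    have sets: "sets (marginal ?\<nu> t) = sets (step_space M)"
      using marginal_prob_algebra[OF \<nu>] by (simp add: space_prob_algebra)
    have "(\<integral>\<omega>. \<psi> (snd (snd (\<omega> t))) \<partial>?L) = (\<integral>x. \<psi> (snd (snd x)) \<partial>marginal ?\<nu> t)"
      unfolding distr_traj_law[OF \<nu>, symmetric]
      by (rule integral_distr[OF comp measurable_utility_reward, symmetric])
    \<comment> \<open>The utility itself has no global bound; on the almost sure range of the
      rewards it equals its clipped version.\<close>
    also have "\<dots> = (\<integral>x. clipped_utility (snd (snd x)) \<partial>marginal ?\<nu> t)"
    proof (rule integral_cong_AE)
      show "AE x in marginal ?\<nu> t. \<psi> (snd (snd x)) = clipped_utility (snd (snd x))"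
        using AE_m by eventually_elim (simp add: clipped_utility_def)
    qed (simp_all add: measurable_cong_sets[OF sets refl] measurable_utility_reward measurable_clipped_reward)
    also have "\<dots> = (\<integral>x. (case x of (s, a, r) \<Rightarrow> expected_reward_after t s a) \<partial>?\<nu>)"
      unfolding integral_clipped_reward_marginal[OF s]
      by (rule integral_lift_marginal[OF \<nu> bounded_expected_utility])
    also have "\<dots> = expected_reward_after t s a"
      using reward_kernel_prob_algebra[OF s] measurable_lift_action_fun bounded_expected_reward_after[of t]
      by (subst integral_step_at[OF s]) (auto simp: space_prob_algebra prob_space.prob_space bounded_action_fun_def)
    finally show ?thesis .
  qed
  ultimately show ?thesis by simp
qed

lemma bounded_suminf_action_fun:
  assumes "\<And>t. bounded_action_fun C (h t)"
  shows "bounded_action_fun (C / (1 - discount M)) (\<lambda>s a. \<Sum>t. discount M ^ t * h t s a)"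
proof -
  have [measurable]: "(\<lambda>x. h t (fst x) (snd x)) \<in> borel_measurable (state_space M \<Otimes>\<^sub>M action_space M)" for t
    using assms[of t] by (simp add: bounded_action_fun_def split_beta')
  have "(\<lambda>x. \<Sum>t. discount M ^ t * h t (fst x) (snd x)) \<in> borel_measurable (state_space M \<Otimes>\<^sub>M action_space M)"
    by measurable
  moreover have "\<bar>\<Sum>t. discount M ^ t * h t s a\<bar> \<le> C / (1 - discount M)" if "s \<in> states M" "a \<in> actions M" for s a
    using assms that discount by (intro abs_suminf_geometric_le) (auto simp: bounded_action_fun_def)
  ultimately show ?thesis by (simp add: bounded_action_fun_def split_beta')
qed

lemma bounded_Q_value: "bounded_action_fun (C / (1 - discount M)) (Q_value M pol \<psi>)"
proof -
  let ?h = "\<lambda>s a. \<Sum>t. discount M ^ t * expected_reward_after t s a"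
  have h: "bounded_action_fun (C / (1 - discount M)) ?h"
    by (rule bounded_suminf_action_fun[OF bounded_expected_reward_after])
  have "(\<lambda>(s, a). Q_value M pol \<psi> s a) \<in> borel_measurable (state_space M \<Otimes>\<^sub>M action_space M)
      \<longleftrightarrow> (\<lambda>(s, a). ?h s a) \<in> borel_measurable (state_space M \<Otimes>\<^sub>M action_space M)"
    by (rule measurable_cong)
      (auto simp: space_pair_measure space_state_space space_action_space Q_value_suminf)
  with h show ?thesis by (auto simp: bounded_action_fun_def Q_value_suminf)
qed

lemma V_value_eq: "V_value M pol \<psi> = policy_op (Q_value M pol \<psi>)"
  by (simp add: V_value_def policy_op_def fun_eq_iff)

lemma bounded_V_value: "bounded_state_fun (C / (1 - discount M)) (V_value M pol \<psi>)"
  unfolding V_value_eq by (rule bounded_policy_op[OF bounded_Q_value])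

lemma integral_suminf_prob_algebra:
  assumes "\<mu> \<in> space (prob_algebra N)" "\<And>t. f t \<in> borel_measurable N" "\<And>t x. x \<in> space N \<Longrightarrow> \<bar>f t x\<bar> \<le> C"
  shows "(\<integral>x. (\<Sum>t. discount M ^ t * f t x) \<partial>\<mu>) = (\<Sum>t. discount M ^ t * (\<integral>x. f t x \<partial>\<mu>))"
proof -
  have sets: "sets \<mu> = sets N" and "prob_space \<mu>"
    using assms(1) by (auto simp: space_prob_algebra)
  then show ?thesis
    using assms(2,3) sets_eq_imp_space_eq[OF sets] discount
    by (intro prob_space.integral_geometric_suminf[where C = C]) (auto simp: measurable_cong_sets[OF sets refl])
qed

lemma V_value_suminf:
  assumes s: "s \<in> states M"
  shows "V_value M pol \<psi> s = (\<Sum>t. discount M ^ t * policy_op (expected_reward_after t) s)"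
proof -
  note \<pi> = pol_prob_algebra[OF s]
  have sp: "space (pol s) = actions M"
    using \<pi> sets_eq_imp_space_eq[of "pol s" "action_space M"] by (simp add: space_prob_algebra space_action_space)
  have "V_value M pol \<psi> s = (\<integral>a. (\<Sum>t. discount M ^ t * expected_reward_after t s a) \<partial>pol s)"
    unfolding V_value_def
    by (intro Bochner_Integration.integral_cong) (auto simp: sp Q_value_suminf[OF s])
  also have "\<dots> = (\<Sum>t. discount M ^ t * (\<integral>a. expected_reward_after t s a \<partial>pol s))"
  proof (rule integral_suminf_prob_algebra[OF \<pi>])
    fix t
    have "(\<lambda>(s, a). expected_reward_after t s a) \<in> borel_measurable (state_space M \<Otimes>\<^sub>M action_space M)"
      using bounded_expected_reward_after[of t] by (simp add: bounded_action_fun_def)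
    from measurable_compose[OF measurable_Pair1' this, of s]
    show "expected_reward_after t s \<in> borel_measurable (action_space M)"
      using s by (simp add: space_state_space)
  qed (use bounded_expected_reward_after s in \<open>auto simp: bounded_action_fun_def space_action_space\<close>)
  finally show ?thesis by (simp add: policy_op_def)
qed

text \<open>Once the term at time 0 is split off, every remaining term carries an outermost
  transition. Pulling it out of the series, together with one discount factor, leaves exactly the
  series of V.\<close>

lemma Q_value_bellman:
  assumes s: "s \<in> states M" "a \<in> actions M"
  shows "Q_value M pol \<psi> s a = expected_utility s a + discount M * trans_op (V_value M pol \<psi>) s a"
proof -
  let ?q = "\<lambda>t. discount M ^ t * expected_reward_after t s a"
  note K = trans_kernel_prob_algebra[OF s]
  have sp: "space (trans_kernel M s a) = states M"
    using K sets_eq_imp_space_eq[of "trans_kernel M s a" "state_space M"]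
    by (simp add: space_prob_algebra space_state_space)
  have "summable ?q"
    using bounded_expected_reward_after s discount
    by (intro abs_suminf_geometric_le[of _ C]) (auto simp: bounded_action_fun_def)
  then have "Q_value M pol \<psi> s a = ?q 0 + (\<Sum>t. ?q (Suc t))"
    unfolding Q_value_suminf[OF s] by (subst suminf_split_head) auto
  moreover have "(\<Sum>t. ?q (Suc t)) = discount M * trans_op (V_value M pol \<psi>) s a"
  proof -
    have bd: "bounded_state_fun C (policy_op (expected_reward_after t))" for t
      by (rule bounded_policy_op[OF bounded_expected_reward_after])
    have "trans_op (V_value M pol \<psi>) s a
        = (\<integral>s'. (\<Sum>t. discount M ^ t * policy_op (expected_reward_after t) s') \<partial>trans_kernel M s a)"
      unfolding trans_op_def[of "V_value M pol \<psi>" s a]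
      by (intro Bochner_Integration.integral_cong) (auto simp: sp V_value_suminf)
    also have "\<dots> = (\<Sum>t. discount M ^ t * (\<integral>s'. policy_op (expected_reward_after t) s' \<partial>trans_kernel M s a))"
      using bd by (intro integral_suminf_prob_algebra[OF K]) (auto simp: bounded_state_fun_def space_state_space)
    finally have V: "trans_op (V_value M pol \<psi>) s a
        = (\<Sum>t. discount M ^ t * trans_op (policy_op (expected_reward_after t)) s a)"
      by (simp only: trans_op_def[of "policy_op h" s a for h])
    have "summable (\<lambda>t. discount M ^ t * trans_op (policy_op (expected_reward_after t)) s a)"
      using bounded_trans_op[OF bd] s discount
      by (intro abs_suminf_geometric_le[of _ C]) (auto simp: bounded_action_fun_def)
    then show ?thesis
      unfolding V by (subst suminf_mult[symmetric]) (auto simp: mult.assoc)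
  qed
  ultimately show ?thesis by simp
qed

end

section \<open>The occupancy measure\<close>

context mdp_policy
begin

lemma start_prob_algebra: "init_law M \<bind> step_from M pol \<in> space (prob_algebra (step_space M))"
  by (rule init_step_prob_algebra[OF measurable_pol])

lemma measurable_fst_step_space: "fst \<in> step_space M \<rightarrow>\<^sub>M state_space M"
  unfolding step_space_def by (rule measurable_fst)

lemma state_law_marginal:
  "state_law M pol t = distr (marginal (init_law M \<bind> step_from M pol) t) (state_space M) fst"
  unfolding state_law_def distr_traj_law[OF start_prob_algebra, symmetric]
  by (subst distr_distr[OF measurable_fst_step_space measurable_component_traj_law[OF start_prob_algebra]])
    (simp add: comp_def)

lemma sets_marginal_start: "sets (marginal (init_law M \<bind> step_from M pol) t) = sets (step_space M)"
  using marginal_prob_algebra[OF start_prob_algebra] by (simp add: space_prob_algebra)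

lemma state_law_prob_algebra: "state_law M pol t \<in> space (prob_algebra (state_space M))"
proof -
  have "prob_space (marginal (init_law M \<bind> step_from M pol) t)"
    using marginal_prob_algebra[OF start_prob_algebra] by (simp add: space_prob_algebra)
  then show ?thesis
    unfolding state_law_marginal
    by (auto simp: space_prob_algebra measurable_cong_sets[OF sets_marginal_start refl] measurable_fst_step_space
        intro: prob_space.prob_space_distr)
qed

lemma integral_state_law:
  fixes f :: "'s \<Rightarrow> real"
  assumes "f \<in> borel_measurable (state_space M)"
  shows "(\<integral>s. f s \<partial>state_law M pol t) = (\<integral>x. f (fst x) \<partial>marginal (init_law M \<bind> step_from M pol) t)"
  unfolding state_law_marginal
  by (rule integral_distr[OF _ assms])
    (simp add: measurable_cong_sets[OF sets_marginal_start refl] measurable_fst_step_space)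

lemma integral_fst_step_from:
  assumes "s \<in> states M" "bounded_state_fun C f"
  shows "(\<integral>x. f (fst x) \<partial>step_from M pol s) = f s"
proof -
  have "(\<lambda>x. f (fst x)) \<in> borel_measurable (state_space M \<Otimes>\<^sub>M action_space M)"
    using assms(2) by (intro measurable_compose[OF measurable_fst]) (auto simp: bounded_state_fun_def)
  then have "bounded_action_fun C (\<lambda>s a. f s)"
    using assms(2) by (auto simp: bounded_action_fun_def bounded_state_fun_def split_beta')
  from integral_lift_step_from[OF assms(1) this]
  show ?thesis
    using pol_prob_algebra[OF assms(1)]
    by (simp add: policy_op_def split_beta' space_prob_algebra prob_space.prob_space)
qed

lemma bounded_fst:
  assumes "bounded_state_fun C f"
  shows "(\<lambda>x. f (fst x)) \<in> borel_measurable (step_space M)"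
    and "x \<in> space (step_space M) \<Longrightarrow> \<bar>f (fst x)\<bar> \<le> C"
  using assms measurable_compose[OF measurable_fst_step_space]
  by (auto simp: bounded_state_fun_def space_step_space)

lemma integral_state_law_0:
  assumes f: "bounded_state_fun C f"
  shows "(\<integral>s. f s \<partial>state_law M pol 0) = (\<integral>s. f s \<partial>init_law M)"
proof -
  have "(\<integral>s. f s \<partial>state_law M pol 0) = (\<integral>x. f (fst x) \<partial>(init_law M \<bind> step_from M pol))"
    using f by (subst integral_state_law) (auto simp: bounded_state_fun_def)
  also have "\<dots> = (\<integral>s. (\<integral>x. f (fst x) \<partial>step_from M pol s) \<partial>init_law M)"
    by (rule integral_bind_prob_algebra[OF init_law_prob_algebra measurable_step_from[OF measurable_pol] bounded_fst[OF f]])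
  also have "\<dots> = (\<integral>s. f s \<partial>init_law M)"
    by (intro Bochner_Integration.integral_cong) (auto simp: init_law_def space_state_space integral_fst_step_from[OF _ f])
  finally show ?thesis .
qed

lemma space_marginal_start:
  "space (marginal (init_law M \<bind> step_from M pol) t) = states M \<times> actions M \<times> UNIV"
  using sets_eq_imp_space_eq[OF sets_marginal_start] by (simp add: space_step_space)

text \<open>Given the state at time \<open>t\<close>, the rest of the triple is distributed by a
  fresh \<open>step_from\<close>.\<close>

lemma integral_marginal_start:
  fixes F :: "'s \<times> 'a \<times> real \<Rightarrow> real"
  assumes F: "F \<in> borel_measurable (step_space M)" "\<And>x. x \<in> space (step_space M) \<Longrightarrow> \<bar>F x\<bar> \<le> C"
  shows "(\<integral>x. F x \<partial>marginal (init_law M \<bind> step_from M pol) t)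
      = (\<integral>s. (\<integral>x. F x \<partial>step_from M pol s) \<partial>state_law M pol t)"
proof -
  let ?g = "\<lambda>s. \<integral>x. F x \<partial>step_from M pol s"
  have g: "bounded_state_fun C ?g"
    unfolding bounded_state_fun_def
    using measurable_integral_prob_algebra[OF measurable_step_from[OF measurable_pol] F(1)]
      abs_integral_prob_algebra_le[OF step_from_prob_algebra F] by auto
  show ?thesis
  proof (cases t)
    case 0
    then show ?thesis
      unfolding 0 integral_state_law_0[OF g] marginal.simps
      by (intro integral_bind_prob_algebra[OF init_law_prob_algebra measurable_step_from[OF measurable_pol] F])
  next
    case (Suc n)
    \<comment> \<open>\<open>F\<close> and its conditional mean \<open>?g\<close> composed with
      \<open>fst\<close> have the same average under \<open>step_from\<close>, so the recursion for
      marginals sends both to the same integral.\<close>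
    have "(\<integral>x. ?g (fst x) \<partial>marginal (init_law M \<bind> step_from M pol) (Suc n))
        = (\<integral>x. (case x of (s, a, r) \<Rightarrow> trans_op (\<lambda>s'. \<integral>x. ?g (fst x) \<partial>step_from M pol s') s a)
            \<partial>marginal (init_law M \<bind> step_from M pol) n)"
      by (rule integral_marginal_Suc[OF start_prob_algebra bounded_fst[OF g]])
    also have "\<dots> = (\<integral>x. (case x of (s, a, r) \<Rightarrow> trans_op ?g s a)
            \<partial>marginal (init_law M \<bind> step_from M pol) n)"
      by (intro Bochner_Integration.integral_cong)
        (auto simp: space_marginal_start integral_fst_step_from[OF _ g] intro!: trans_op_cong)
    also have "\<dots> = (\<integral>x. F x \<partial>marginal (init_law M \<bind> step_from M pol) (Suc n))"
      by (rule integral_marginal_Suc[OF start_prob_algebra F, symmetric])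
    finally show ?thesis
      using g by (simp add: Suc integral_state_law bounded_state_fun_def del: marginal.simps)
  qed
qed

text \<open>The evolution of the state law is dual to T, which is how T comes to be paired with the
  occupancy.\<close>

lemma integral_state_law_Suc:
  assumes f: "bounded_state_fun C f"
  shows "(\<integral>s. f s \<partial>state_law M pol (Suc t)) = (\<integral>s. policy_op (trans_op f) s \<partial>state_law M pol t)"
proof -
  note b = bounded_trans_op[OF f]
  have lift: "(\<lambda>(s, a, r). trans_op f s a) \<in> borel_measurable (step_space M)"
    using measurable_lift_action_fun b by (auto simp: bounded_action_fun_def)
  have bd: "\<bar>(case x of (s, a, r) \<Rightarrow> trans_op f s a)\<bar> \<le> C" if "x \<in> space (step_space M)" for x
    using that b by (auto simp: bounded_action_fun_def space_step_space)
  have "(\<integral>s. f s \<partial>state_law M pol (Suc t))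
      = (\<integral>x. f (fst x) \<partial>marginal (init_law M \<bind> step_from M pol) (Suc t))"
    using f by (subst integral_state_law) (auto simp: bounded_state_fun_def)
  also have "\<dots> = (\<integral>x. (case x of (s, a, r) \<Rightarrow> trans_op (\<lambda>s'. \<integral>x. f (fst x) \<partial>step_from M pol s') s a)
            \<partial>marginal (init_law M \<bind> step_from M pol) t)"
    by (rule integral_marginal_Suc[OF start_prob_algebra bounded_fst[OF f]])
  also have "\<dots> = (\<integral>x. (case x of (s, a, r) \<Rightarrow> trans_op f s a)
            \<partial>marginal (init_law M \<bind> step_from M pol) t)"
    by (intro Bochner_Integration.integral_cong)
      (auto simp: space_marginal_start integral_fst_step_from[OF _ f] intro!: trans_op_cong)
  also have "\<dots> = (\<integral>s. (\<integral>x. (case x of (s, a, r) \<Rightarrow> trans_op f s a) \<partial>step_from M pol s) \<partial>state_law M pol t)"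
    by (rule integral_marginal_start[OF lift bd])
  also have "\<dots> = (\<integral>s. policy_op (trans_op f) s \<partial>state_law M pol t)"
    using state_law_prob_algebra[of t] sets_eq_imp_space_eq[of "state_law M pol t" "state_space M"]
    by (intro Bochner_Integration.integral_cong)
      (auto simp: space_prob_algebra space_state_space integral_lift_step_from[OF _ b])
  finally show ?thesis .
qed

text \<open>Makes \<open>RN_deriv\<close> a true density of the state law. The initial law and all
  transition kernels have densities, so null sets are missed at time 0 and again after every
  transition.\<close>

lemma state_law_absolutely_continuous: "absolutely_continuous (state_space M) (state_law M pol t)"
  unfolding absolutely_continuous_def
proof
  fix N assume N: "N \<in> null_sets (state_space M)"
  then have N': "N \<in> sets (state_space M)" by auto
  have sets: "sets (state_law M pol t) = sets (state_space M)" and "prob_space (state_law M pol t)"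
    using state_law_prob_algebra[of t] by (auto simp: space_prob_algebra)
  interpret L: prob_space "state_law M pol t" by fact
  have ind: "bounded_state_fun 1 (indicator N)"
    using N' by (auto simp: bounded_state_fun_def indicator_def)
  have "(\<integral>s. indicator N s \<partial>state_law M pol t) = (0::real)"
  proof (cases t)
    case 0
    have "N \<in> null_sets (init_law M)"
      using N absolutely_continuousI_density[of "\<lambda>s. ennreal (init_density M s)" "state_space M"] measurable_init
      by (auto simp: absolutely_continuous_def init_law_def)
    then have "measure (init_law M) N = 0" by (simp add: null_sets_def measure_def)
    then show ?thesis
      unfolding 0 integral_state_law_0[OF ind] using N' by (simp add: init_law_def sets.Int_space_eq2)
  next
    case (Suc n)
    have z: "trans_op (indicator N) s a = 0" if s: "s \<in> states M" "a \<in> actions M" for s a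
    proof -
      have "N \<in> null_sets (trans_kernel M s a)"
        using N measurable_trans_density[OF s]
          absolutely_continuousI_density[of "\<lambda>s'. ennreal (trans_density M s' s a)" "state_space M"]
        by (auto simp: absolutely_continuous_def trans_kernel_def)
      then have "measure (trans_kernel M s a) N = 0" by (simp add: null_sets_def measure_def)
      then show ?thesis
        using N' by (simp add: trans_op_def trans_kernel_def sets.Int_space_eq2)
    qed
    have "policy_op (trans_op (indicator N)) s = 0" if s: "s \<in> states M" for s
    proof -
      have "space (pol s) = actions M"
        using pol_prob_algebra[OF s] sets_eq_imp_space_eq[of "pol s" "action_space M"]
        by (simp add: space_prob_algebra space_action_space)
      then have "policy_op (trans_op (indicator N)) s = (\<integral>a. 0 \<partial>pol s)"
        unfolding policy_op_def by (intro Bochner_Integration.integral_cong) (auto simp: z[OF s])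
      then show ?thesis by simp
    qed
    then have "(\<integral>s. policy_op (trans_op (indicator N)) s \<partial>state_law M pol n) = (\<integral>s. 0 \<partial>state_law M pol n)"
      using state_law_prob_algebra[of n] sets_eq_imp_space_eq[of "state_law M pol n" "state_space M"]
      by (intro Bochner_Integration.integral_cong) (auto simp: space_prob_algebra space_state_space)
    then show ?thesis unfolding Suc integral_state_law_Suc[OF ind] by simp
  qed
  then have "measure (state_law M pol t) N = 0"
    using N' sets by (simp add: sets.Int_space_eq2)
  then show "N \<in> null_sets (state_law M pol t)"
    using N' sets by (simp add: null_sets_def L.emeasure_eq_measure)
qed

section \<open>Densities of the state laws and the occupancy\<close>

lemma state_density_nonneg: "0 \<le> state_density M pol t s"
  by (simp add: state_density_def)

lemma measurable_state_density: "state_density M pol t \<in> borel_measurable (state_space M)"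
  unfolding state_density_def[abs_def] by measurable

lemma
  assumes f: "bounded_state_fun C f"
  shows integrable_state_density: "integrable (state_space M) (\<lambda>s. state_density M pol t s * f s)"
    and integral_state_density: "(\<integral>s. state_density M pol t s * f s \<partial>state_space M) = (\<integral>s. f s \<partial>state_law M pol t)"
proof -
  interpret S: finite_measure "state_space M" by (rule finite_measure_state_space)
  have sets: "sets (state_law M pol t) = sets (state_space M)" and "prob_space (state_law M pol t)"
    using state_law_prob_algebra[of t] by (auto simp: space_prob_algebra)
  then interpret L: prob_space "state_law M pol t" by simp
  have meas: "f \<in> borel_measurable (state_space M)" using f by (simp add: bounded_state_fun_def)
  have "integrable (state_law M pol t) f"
    using f by (intro integrable_prob_algebra[OF state_law_prob_algebra])
      (auto simp: bounded_state_fun_def space_state_space)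
  then show "integrable (state_space M) (\<lambda>s. state_density M pol t s * f s)"
    unfolding state_density_def
    using S.RN_deriv_integrable[OF L.sigma_finite_measure_axioms state_law_absolutely_continuous sets meas] by simp
  show "(\<integral>s. state_density M pol t s * f s \<partial>state_space M) = (\<integral>s. f s \<partial>state_law M pol t)"
    unfolding state_density_def
    using S.RN_deriv_integral[OF L.sigma_finite_measure_axioms state_law_absolutely_continuous sets meas] by simp
qed

lemma bounded_one: "bounded_state_fun 1 (\<lambda>_. 1)"
  by (simp add: bounded_state_fun_def)

lemma state_law_total: "(\<integral>s. 1 \<partial>state_law M pol t) = (1::real)"
  using state_law_prob_algebra[of t] by (simp add: space_prob_algebra prob_space.prob_space)

text \<open>The occupancy is a real series, meaningful only where it converges. Summed in the
  extended nonnegative reals, it integrates to the geometric series, since each density has mass 1;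
  a finite integral forces convergence almost everywhere.\<close>

lemma AE_summable_state_density:
  "AE s in state_space M. summable (\<lambda>t. discount M ^ t * state_density M pol t s)"
proof -
  note [measurable] = measurable_state_density
  have \<gamma>: "0 \<le> discount M ^ t" for t using discount by simp
  have "(\<integral>\<^sup>+s. (\<Sum>t. ennreal (discount M ^ t * state_density M pol t s)) \<partial>state_space M)
      = (\<Sum>t. \<integral>\<^sup>+s. ennreal (discount M ^ t * state_density M pol t s) \<partial>state_space M)"
    by (rule nn_integral_suminf) measurable
  also have "\<dots> = (\<Sum>t. ennreal (discount M ^ t))"
  proof (rule arg_cong[where f = suminf], rule ext)
    fix t
    have "(\<integral>\<^sup>+s. ennreal (discount M ^ t * state_density M pol t s) \<partial>state_space M)
        = ennreal (\<integral>s. discount M ^ t * state_density M pol t s \<partial>state_space M)"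
      using integrable_state_density[OF bounded_one, of t] \<gamma>[of t]
      by (intro nn_integral_eq_integral) (auto simp: state_density_nonneg)
    also have "(\<integral>s. discount M ^ t * state_density M pol t s \<partial>state_space M) = discount M ^ t"
      using integral_state_density[OF bounded_one, of t] unfolding state_law_total by simp
    finally show "(\<integral>\<^sup>+s. ennreal (discount M ^ t * state_density M pol t s) \<partial>state_space M) = ennreal (discount M ^ t)" .
  qed
  also have "\<dots> \<noteq> \<infinity>"
    using summable_geometric[of "discount M"] discount \<gamma> by (simp add: ennreal_suminf_neq_top)
  finally have "AE s in state_space M. (\<Sum>t. ennreal (discount M ^ t * state_density M pol t s)) \<noteq> \<infinity>"
    by (intro nn_integral_PInf_AE) auto
  then show ?thesis
  proof eventually_elim
    case (elim s)
    then show ?case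
      using \<gamma> by (intro summable_suminf_not_top) (auto simp: state_density_nonneg)
  qed
qed

lemma measurable_occupancy: "occupancy M pol \<in> borel_measurable (state_space M)"
proof -
  note [measurable] = measurable_state_density
  show ?thesis unfolding occupancy_def[abs_def] by measurable
qed

lemma
  assumes f: "bounded_state_fun C f"
  shows integrable_occupancy: "integrable (state_space M) (\<lambda>s. occupancy M pol s * f s)"
    and integral_occupancy: "(\<integral>s. occupancy M pol s * f s \<partial>state_space M)
      = (\<Sum>t. discount M ^ t * (\<integral>s. f s \<partial>state_law M pol t))"
proof -
  let ?g = "\<lambda>t s. discount M ^ t * (state_density M pol t s * f s)"
  have fm[measurable]: "f \<in> borel_measurable (state_space M)" using f by (simp add: bounded_state_fun_def)
  note [measurable] = measurable_state_density measurable_occupancy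
  have f': "bounded_state_fun C (\<lambda>s. \<bar>f s\<bar>)"
    using f by (auto simp: bounded_state_fun_def)
  have int: "integrable (state_space M) (?g t)" for t
    using integrable_state_density[OF f, of t] by simp
  have ae: "AE s in state_space M. summable (\<lambda>t. norm (?g t s))"
    using AE_summable_state_density
  proof eventually_elim
    case (elim s)
    then show ?case
      using discount summable_mult2[OF elim, of "\<bar>f s\<bar>"]
      by (simp add: abs_mult state_density_nonneg mult.assoc)
  qed
  have "norm (\<integral>s. norm (?g t s) \<partial>state_space M) \<le> discount M ^ t * C" for t
  proof -
    have "(\<integral>s. norm (?g t s) \<partial>state_space M)
        = discount M ^ t * (\<integral>s. state_density M pol t s * \<bar>f s\<bar> \<partial>state_space M)"
      using discount by (simp add: abs_mult state_density_nonneg)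
    also have "\<dots> = discount M ^ t * (\<integral>s. \<bar>f s\<bar> \<partial>state_law M pol t)"
      by (simp add: integral_state_density[OF f'])
    finally have eq: "(\<integral>s. norm (?g t s) \<partial>state_space M) = discount M ^ t * (\<integral>s. \<bar>f s\<bar> \<partial>state_law M pol t)" .
    have "\<bar>\<integral>s. \<bar>f s\<bar> \<partial>state_law M pol t\<bar> \<le> C"
      using f' by (intro abs_integral_prob_algebra_le[OF state_law_prob_algebra])
        (auto simp: bounded_state_fun_def space_state_space)
    then show ?thesis
      unfolding eq using discount by (simp add: abs_mult mult_left_mono)
  qed
  then have sum: "summable (\<lambda>t. \<integral>s. norm (?g t s) \<partial>state_space M)"
    using discount by (intro summable_comparison_test'[OF summable_mult2[OF summable_geometric]]) auto
  \<comment> \<open>The factor \<open>f s\<close> leaves the series only where the series converges,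
    hence an equality almost everywhere.\<close>
  have eq: "AE s in state_space M. (\<Sum>t. ?g t s) = occupancy M pol s * f s"
    using AE_summable_state_density
  proof eventually_elim
    case (elim s)
    then show ?case
      unfolding occupancy_def using suminf_mult2[OF elim, of "f s"] by (simp add: mult.assoc)
  qed
  have "integrable (state_space M) (\<lambda>s. \<Sum>t. ?g t s)"
    by (rule integrable_suminf[OF int ae sum])
  then show "integrable (state_space M) (\<lambda>s. occupancy M pol s * f s)"
    by (rule integrable_cong_AE_imp) (use eq in \<open>auto elim: eventually_mono\<close>)
  have "(\<integral>s. occupancy M pol s * f s \<partial>state_space M) = (\<integral>s. (\<Sum>t. ?g t s) \<partial>state_space M)"
    by (rule integral_cong_AE) (use eq in \<open>auto elim: eventually_mono\<close>)
  also have "\<dots> = (\<Sum>t. \<integral>s. ?g t s \<partial>state_space M)"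
    by (rule integral_suminf[OF int ae sum])
  finally show "(\<integral>s. occupancy M pol s * f s \<partial>state_space M)
      = (\<Sum>t. discount M ^ t * (\<integral>s. f s \<partial>state_law M pol t))"
    by (simp add: integral_state_density[OF f])
qed

text \<open>With m(t) the mean of \<open>f\<close> at time t, the left side is the sum of \<gamma>^t
  m(t) - \<gamma>^(t+1) m(t+1). It telescopes to m(0), as boundedness of \<open>f\<close> makes the
  remainder vanish.\<close>

lemma occupancy_balance:
  assumes f: "bounded_state_fun C f"
  shows "(\<integral>s. occupancy M pol s * (f s - discount M * policy_op (trans_op f) s) \<partial>state_space M)
      = (\<integral>s. f s \<partial>init_law M)"
proof -
  let ?m = "\<lambda>t. \<integral>s. f s \<partial>state_law M pol t"
  let ?P = "policy_op (trans_op f)"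
  have P: "bounded_state_fun C ?P"
    by (rule bounded_policy_op[OF bounded_trans_op[OF f]])
  have C: "\<bar>f s - discount M * ?P s\<bar> \<le> 2 * C" if s: "s \<in> states M" for s
  proof -
    have "\<bar>f s\<bar> \<le> C" "\<bar>?P s\<bar> \<le> C"
      using f P s by (auto simp: bounded_state_fun_def)
    moreover have "\<bar>discount M * ?P s\<bar> \<le> 1 * \<bar>?P s\<bar>"
      unfolding abs_mult using discount by (intro mult_right_mono) auto
    ultimately show ?thesis by linarith
  qed
  have b: "bounded_state_fun (2 * C) (\<lambda>s. f s - discount M * ?P s)"
    using f P C by (auto simp: bounded_state_fun_def)
  have m: "\<bar>?m t\<bar> \<le> C" for t
    using f by (intro abs_integral_prob_algebra_le[OF state_law_prob_algebra])
      (auto simp: bounded_state_fun_def space_state_space)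
  have int: "integrable (state_law M pol t) g" if "bounded_state_fun C g" for t g
    using that by (intro integrable_prob_algebra[OF state_law_prob_algebra])
      (auto simp: bounded_state_fun_def space_state_space)
  have "discount M ^ t * (\<integral>s. f s - discount M * ?P s \<partial>state_law M pol t)
      = discount M ^ t * ?m t - discount M ^ Suc t * ?m (Suc t)" for t
    using int[OF f, of t] int[OF P, of t] integral_state_law_Suc[OF f, of t] by (simp add: algebra_simps)
  moreover have "(\<lambda>t. discount M ^ t * ?m t) \<longlonglongrightarrow> 0"
    using m discount by (intro summable_LIMSEQ_zero abs_suminf_geometric_le[of _ C]) auto
  then have "(\<lambda>t. discount M ^ t * ?m t - discount M ^ Suc t * ?m (Suc t)) sums (discount M ^ 0 * ?m 0 - 0)"
    by (rule telescope_sums')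
  ultimately have "(\<Sum>t. discount M ^ t * (\<integral>s. f s - discount M * ?P s \<partial>state_law M pol t)) = ?m 0"
    by (simp add: sums_iff)
  then show ?thesis
    unfolding integral_occupancy[OF b] by (simp add: integral_state_law_0[OF f])
qed

end

section \<open>Regularity in the action and in the parameters\<close>

text \<open>Identities such as the Bellman equation hold only on the open set of actions, so
  derivatives have to be transferred locally.\<close>

lemma GDERIV_cong_ball:
  assumes "GDERIV f x :> D" "0 < e" "\<And>y. y \<in> ball x e \<Longrightarrow> f y = g y"
  shows "GDERIV g x :> D"
  using assms unfolding gderiv_def
  by (auto intro: has_derivative_transform_within_open[of f _ x UNIV "ball x e"])

text \<open>\<open>f - H\<close> has increments of second order at \<open>x\<close>, hence
  derivative zero there. In the application \<open>H\<close> keeps the occupancy and the action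
  value of the base parameter fixed.\<close>

lemma GDERIV_quadratic_error:
  assumes H: "GDERIV H x :> D" and e: "0 < e"
    and err: "\<And>y. y \<in> ball x e \<Longrightarrow> \<bar>f y - f x - (H y - H x)\<bar> \<le> c * (norm (y - x))\<^sup>2"
  shows "GDERIV f x :> D"
proof -
  define R where "R y = f y - H y" for y
  have "(R has_derivative (\<lambda>_. 0)) (at x)"
    unfolding has_derivative_iff_norm
  proof
    show "((\<lambda>y. norm (R y - R x - 0) / norm (y - x)) \<longlongrightarrow> 0) (at x)"
    proof (rule tendsto_sandwich)
      show "\<forall>\<^sub>F y in at x. 0 \<le> norm (R y - R x - 0) / norm (y - x)"
        by simp
      show "\<forall>\<^sub>F y in at x. norm (R y - R x - 0) / norm (y - x) \<le> c * norm (y - x)"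
        unfolding eventually_at
      proof (intro exI[of _ e] conjI ballI impI e)
        fix y assume y: "y \<noteq> x \<and> dist y x < e"
        have "norm (R y - R x - 0) \<le> c * norm (y - x) * norm (y - x)"
          using err[of y] y by (simp add: R_def dist_commute power2_eq_square algebra_simps)
        then show "norm (R y - R x - 0) / norm (y - x) \<le> c * norm (y - x)"
          using y by (simp add: divide_le_eq)
      qed
      show "((\<lambda>y. c * norm (y - x)) \<longlongrightarrow> 0) (at x)"
        by (auto intro!: tendsto_eq_intros)
    qed simp
  qed simp
  from has_derivative_add[OF H[unfolded gderiv_def] this]
  show ?thesis by (simp add: gderiv_def R_def)
qed

text \<open>Gives names to bounds whose existence alone is asserted by the hypotheses:
  \<open>B\<close> for rewards, \<open>L\<close> for gradients in the action, \<open>C\<close> and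
  \<open>K\<close> for the utility and its derivative where rewards can lie.\<close>

locale push_forward_mdp = mdp M + push_forward_policy M X \<Xi> \<Theta> \<pi>
  for M :: "('s::euclidean_space, 'a::euclidean_space, 'w) mdp"
    and X :: "'x::euclidean_space set" and \<Xi> and \<Theta> :: "'p::euclidean_space set" and \<pi> +
  fixes \<psi> :: "real \<Rightarrow> real" and B C K L :: real
  assumes regular_policy: "regular_policy M X \<Theta> \<pi>"
    and trans_differentiable:
      "\<lbrakk>s' \<in> states M; s \<in> states M; a \<in> actions M\<rbrakk> \<Longrightarrow> trans_density M s' s differentiable (at a)"
    and trans_gradient_le:
      "\<lbrakk>s' \<in> states M; s \<in> states M; a \<in> actions M\<rbrakk> \<Longrightarrow> norm (gradient (trans_density M s' s) a) \<le> L"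
    and reward_le: "\<lbrakk>s \<in> states M; a \<in> actions M; w \<in> space (noise M)\<rbrakk> \<Longrightarrow> \<bar>reward M s a w\<bar> \<le> B"
    and reward_differentiable:
      "\<lbrakk>s \<in> states M; a \<in> actions M; w \<in> space (noise M)\<rbrakk> \<Longrightarrow> (\<lambda>a. reward M s a w) differentiable (at a)"
    and reward_gradient_le:
      "\<lbrakk>s \<in> states M; a \<in> actions M; w \<in> space (noise M)\<rbrakk> \<Longrightarrow> norm (gradient (\<lambda>a. reward M s a w) a) \<le> L"
    and utility_DERIV: "DERIV \<psi> x :> deriv \<psi> x"
    and utility_deriv_le: "\<bar>x\<bar> \<le> B \<Longrightarrow> \<bar>deriv \<psi> x\<bar> \<le> K"
    and utility_le: "\<bar>x\<bar> \<le> B \<Longrightarrow> \<bar>\<psi> x\<bar> \<le> C"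
    and nonneg: "0 \<le> C" "0 \<le> K" "0 \<le> L"
begin

abbreviation "pol \<equiv> push_forward M \<Xi> \<pi>"

lemma measurable_utility: "\<psi> \<in> borel_measurable borel"
  by (intro borel_measurable_continuous_onI DERIV_continuous_on[where D = "deriv \<psi>"]) (rule utility_DERIV)

lemma bounded_utility: "\<theta> \<in> \<Theta> \<Longrightarrow> bounded_utility_mdp M (pol \<theta>) \<psi> B C"
  using measurable_push_forward[OF mdp_axioms push_forward_policy_axioms regular_policy]
  by unfold_locales (auto intro: measurable_utility reward_le utility_le nonneg)

lemma space_base: "space \<Xi> = X"
  using sets_eq_imp_space_eq[OF sets_base] by (simp add: space_restrict_space)

lemma space_state_base: "space (state_space M \<Otimes>\<^sub>M \<Xi>) = states M \<times> X"
  by (simp add: space_pair_measure space_state_space space_base)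

lemma measurable_policy:
  assumes \<theta>: "\<theta> \<in> \<Theta>"
  shows "(\<lambda>z. \<pi> (fst z) (snd z) \<theta>) \<in> state_space M \<Otimes>\<^sub>M \<Xi> \<rightarrow>\<^sub>M action_space M"
proof -
  have "continuous_on (states M \<times> X) (\<lambda>z. (fst z, snd z, \<theta>))"
    by (intro continuous_intros)
  with regular_policy[unfolded regular_policy_def, THEN conjunct1]
  have "continuous_on (states M \<times> X) (\<lambda>z. case (fst z, snd z, \<theta>) of (s, \<xi>, \<theta>) \<Rightarrow> \<pi> s \<xi> \<theta>)"
    by (rule continuous_on_compose2) (use \<theta> in auto)
  then have cont: "(\<lambda>z. \<pi> (fst z) (snd z) \<theta>) \<in> borel_measurable (restrict_space borel (states M \<times> X))"
    by (intro borel_measurable_continuous_on_restrict) simp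
  have "(\<lambda>s. s) \<in> state_space M \<rightarrow>\<^sub>M borel"
    unfolding state_space_def by (rule measurable_restrict_space1) simp
  moreover have "(\<lambda>\<xi>. \<xi>) \<in> \<Xi> \<rightarrow>\<^sub>M borel"
    unfolding measurable_cong_sets[OF sets_base refl] by (rule measurable_restrict_space1) simp
  ultimately have "(\<lambda>z. (fst z, snd z)) \<in> state_space M \<Otimes>\<^sub>M \<Xi> \<rightarrow>\<^sub>M borel"
    by (intro borel_measurable_Pair measurable_compose[OF measurable_fst] measurable_compose[OF measurable_snd])
  then have "(\<lambda>z. z) \<in> state_space M \<Otimes>\<^sub>M \<Xi> \<rightarrow>\<^sub>M restrict_space borel (states M \<times> X)"
    by (intro measurable_restrict_space2) (auto simp: space_state_base)
  from measurable_compose[OF this cont]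
  have "(\<lambda>z. \<pi> (fst z) (snd z) \<theta>) \<in> borel_measurable (state_space M \<Otimes>\<^sub>M \<Xi>)" .
  then show ?thesis
    unfolding action_space_def using policy_actions \<theta>
    by (intro measurable_restrict_space2) (auto simp: space_state_base)
qed

lemma measurable_state_policy:
  assumes "\<theta> \<in> \<Theta>" "(\<lambda>(s, a). h s a) \<in> borel_measurable (state_space M \<Otimes>\<^sub>M action_space M)"
  shows "(\<lambda>z. h (fst z) (\<pi> (fst z) (snd z) \<theta>)) \<in> borel_measurable (state_space M \<Otimes>\<^sub>M \<Xi>)"
proof -
  have "(\<lambda>z. (fst z, \<pi> (fst z) (snd z) \<theta>)) \<in> state_space M \<Otimes>\<^sub>M \<Xi> \<rightarrow>\<^sub>M state_space M \<Otimes>\<^sub>M action_space M"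
    using measurable_policy[OF assms(1)] by (intro measurable_Pair) simp_all
  from measurable_compose[OF this assms(2)] show ?thesis by simp
qed

lemma bounded_action_funD:
  assumes "\<theta> \<in> \<Theta>" "bounded_action_fun D h" "s \<in> states M"
  shows "(\<lambda>\<xi>. h s (\<pi> s \<xi> \<theta>)) \<in> borel_measurable \<Xi>"
    and "integrable \<Xi> (\<lambda>\<xi>. h s (\<pi> s \<xi> \<theta>))"
proof -
  interpret prob_space \<Xi> by (rule prob_base)
  have "(\<lambda>(s, a). h s a) \<in> borel_measurable (state_space M \<Otimes>\<^sub>M action_space M)"
    using assms(2) by (simp add: bounded_action_fun_def)
  from measurable_compose[OF measurable_Pair1' measurable_state_policy[OF assms(1) this], of s]
  show *: "(\<lambda>\<xi>. h s (\<pi> s \<xi> \<theta>)) \<in> borel_measurable \<Xi>"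
    using assms(3) by (simp add: space_state_space)
  show "integrable \<Xi> (\<lambda>\<xi>. h s (\<pi> s \<xi> \<theta>))"
    using assms policy_actions * by (intro integrable_const_bound[of _ D])
      (auto simp: bounded_action_fun_def space_base)
qed

text \<open>Change of variables: the parameter leaves the measure and enters an integrand over the
  fixed base distribution, where it can be differentiated.\<close>

lemma policy_op_push_forward:
  assumes "\<theta> \<in> \<Theta>" "bounded_action_fun D h" "s \<in> states M"
  shows "mdp_policy.policy_op (pol \<theta>) h s = (\<integral>\<xi>. h s (\<pi> s \<xi> \<theta>) \<partial>\<Xi>)"
proof -
  interpret P: bounded_utility_mdp M "pol \<theta>" \<psi> B C by (rule bounded_utility[OF assms(1)])
  have s: "s \<in> space (state_space M)" using assms(3) by (simp add: space_state_space)
  have "h s \<in> borel_measurable (action_space M)"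
    using measurable_compose[OF measurable_Pair1'[OF s], of "\<lambda>(s, a). h s a"] assms(2)
    by (simp add: bounded_action_fun_def)
  moreover have "(\<lambda>\<xi>. \<pi> s \<xi> \<theta>) \<in> \<Xi> \<rightarrow>\<^sub>M action_space M"
    using measurable_compose[OF measurable_Pair1'[OF s] measurable_policy[OF assms(1)]] by simp
  ultimately show ?thesis
    unfolding P.policy_op_def push_forward_def by (intro integral_distr)
qed

section \<open>Gradients in the action and in the parameter\<close>

lemma obtain_action_ball:
  assumes "a \<in> actions M"
  obtains e where "0 < e" "ball a e \<subseteq> actions M"
  using open_actions assms unfolding open_contains_ball by blast

text \<open>Only existence and size of the gradient matter later, so its formula stays inside the
  proof. By the chain rule the constant \<open>K * L\<close> dominates.\<close>

lemma GDERIV_expected_utility: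
  assumes s: "s \<in> states M" and a: "a \<in> actions M"
  obtains D where "GDERIV (\<lambda>a. \<integral>w. \<psi> (reward M s a w) \<partial>noise M) a :> D" "norm D \<le> K * L"
proof -
  interpret N: prob_space "noise M" by (rule prob_noise)
  obtain e where e: "0 < e" "ball a e \<subseteq> actions M" by (rule obtain_action_ball[OF a])
  let ?G = "\<lambda>y w. deriv \<psi> (reward M s y w) *\<^sub>R gradient (\<lambda>a. reward M s a w) y"
  have G: "GDERIV (\<lambda>y. \<psi> (reward M s y w)) y :> ?G y w" if "y \<in> actions M" "w \<in> space (noise M)" for y w
    by (rule GDERIV_DERIV_compose[OF gderiv_gradient[OF reward_differentiable[OF s that]] utility_DERIV])
  have G_le: "norm (?G y w) \<le> K * L" if "y \<in> actions M" "w \<in> space (noise M)" for y w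
    using utility_deriv_le[OF reward_le[OF s that]] reward_gradient_le[OF s that] nonneg
    by (simp add: mult_mono)
  have lip: "\<bar>\<psi> (reward M s y w) - \<psi> (reward M s a w)\<bar> \<le> K * L * norm (y - a)"
    if "y \<in> ball a e" "w \<in> space (noise M)" for y w
    using e that G G_le by (intro GDERIV_imp_bounded_diff[of "ball a e" _ "\<lambda>y. ?G y w"]) auto
  have int: "integrable (noise M) (\<lambda>w. \<psi> (reward M s y w))" if "y \<in> ball a e" for y
  proof (rule N.integrable_const_bound[of _ C])
    have y: "y \<in> actions M" using e that by auto
    then have sy: "(s, y) \<in> space (state_space M \<Otimes>\<^sub>M action_space M)"
      using s by (simp add: space_pair_measure space_state_space space_action_space)
    have "reward M s y \<in> borel_measurable (noise M)"
      using measurable_compose[OF measurable_Pair1'[OF sy] measurable_reward] by simp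
    from measurable_compose[OF this measurable_utility]
    show "(\<lambda>w. \<psi> (reward M s y w)) \<in> borel_measurable (noise M)" .
    show "AE w in noise M. norm (\<psi> (reward M s y w)) \<le> C"
      using utility_le[OF reward_le[OF s y]] by (intro AE_I2) simp
  qed
  have "0 \<le> K * L" using nonneg by simp
  note dom = dominated_GDERIV[where f = "\<lambda>y w. \<psi> (reward M s y w)" and g = "\<lambda>_. K * L" and G = "?G a",
      OF e(1) int G[OF a] _ this lip]
  have "GDERIV (\<lambda>y. \<integral>w. \<psi> (reward M s y w) \<partial>noise M) a :> (\<integral>w. ?G a w \<partial>noise M)"
    by (rule dom(2)) auto
  moreover have "norm (\<integral>w. ?G a w \<partial>noise M) \<le> (\<integral>w. K * L \<partial>noise M)"
    by (rule dom(3)) auto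
  then have "norm (\<integral>w. ?G a w \<partial>noise M) \<le> K * L" by (simp add: N.prob_space)
  ultimately show thesis by (rule that)
qed

text \<open>In the density form \<open>f\<close> is a factor independent of the action, so it enters
  the bound only through its size \<open>D\<close>.\<close>

lemma GDERIV_trans_op:
  assumes s: "s \<in> states M" and a: "a \<in> actions M" and f: "bounded_state_fun D f" and D: "0 \<le> D"
  obtains G where "GDERIV (trans_op f s) a :> G" "norm G \<le> L * D * measure (state_space M) (states M)"
proof -
  interpret S: finite_measure "state_space M" by (rule finite_measure_state_space)
  obtain e where e: "0 < e" "ball a e \<subseteq> actions M" by (rule obtain_action_ball[OF a])
  let ?G = "\<lambda>y s'. f s' *\<^sub>R gradient (trans_density M s' s) y"
  have meas: "f \<in> borel_measurable (state_space M)" and f_le: "\<bar>f s'\<bar> \<le> D" if "s' \<in> states M" for s'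
    using f that by (auto simp: bounded_state_fun_def)
  have f_meas: "f \<in> borel_measurable (state_space M)" using f by (simp add: bounded_state_fun_def)
  have G: "GDERIV (\<lambda>y. trans_density M s' s y * f s') y :> ?G y s'"
    if "y \<in> actions M" "s' \<in> states M" for y s'
    using GDERIV_mult[OF gderiv_gradient[OF trans_differentiable[OF that(2) s that(1)]] GDERIV_const[of "f s'"]]
    by simp
  have G_le: "norm (?G y s') \<le> L * D" if "y \<in> actions M" "s' \<in> states M" for y s'
    using mult_mono[OF trans_gradient_le[OF that(2) s that(1)] f_le[OF that(2)]] nonneg
    by (simp add: mult.commute)
  have lip: "\<bar>trans_density M s' s y * f s' - trans_density M s' s a * f s'\<bar> \<le> L * D * norm (y - a)"
    if "y \<in> ball a e" "s' \<in> space (state_space M)" for y s'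
    using e that G G_le
    by (intro GDERIV_imp_bounded_diff[of "ball a e" _ "\<lambda>y. ?G y s'"]) (auto simp: space_state_space)
  have int: "integrable (state_space M) (\<lambda>s'. trans_density M s' s y * f s')" if "y \<in> ball a e" for y
  proof -
    have y: "y \<in> actions M" using e that by auto
    interpret T: prob_space "trans_kernel M s y" by (rule prob_trans[OF s y])
    have "integrable (trans_kernel M s y) f"
      by (rule integrable_prob_algebra[OF trans_kernel_prob_algebra[OF s y] f_meas, of D])
        (auto simp: space_state_space f_le)
    then show ?thesis
      unfolding trans_kernel_def
      using trans_nonneg[OF _ s y] measurable_trans_density[OF s y] f_meas
      by (subst (asm) integrable_real_density) (auto simp: space_state_space)
  qed
  have "0 \<le> L * D" using nonneg D by simp
  note dom = dominated_GDERIV[where f = "\<lambda>y s'. trans_density M s' s y * f s'" and g = "\<lambda>_. L * D" and G = "?G a",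
      OF e(1) int G[OF a] _ this lip, unfolded space_state_space]
  have "GDERIV (\<lambda>y. \<integral>s'. trans_density M s' s y * f s' \<partial>state_space M) a :> (\<integral>s'. ?G a s' \<partial>state_space M)"
    by (rule dom(2)) auto
  then have "GDERIV (trans_op f s) a :> (\<integral>s'. ?G a s' \<partial>state_space M)"
    by (rule GDERIV_cong_ball[OF _ e(1)]) (use e s f_meas in \<open>auto simp: trans_op_density\<close>)
  moreover have "norm (\<integral>s'. ?G a s' \<partial>state_space M) \<le> (\<integral>s'. L * D \<partial>state_space M)"
    by (rule dom(3)) auto
  then have "norm (\<integral>s'. ?G a s' \<partial>state_space M) \<le> L * D * measure (state_space M) (states M)"
    by (simp add: space_state_space mult_ac)
  ultimately show thesis by (rule that)
qed

text \<open>One summand for each term of the Bellman equation: \<open>K * L\<close> for the expected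
  utility, and the discounted bound from \<open>GDERIV_trans_op\<close> for V, whose size is at most
  \<open>C / (1 - discount M)\<close>. The constant is the same for all parameters.\<close>

definition Q_lipschitz :: real where
  "Q_lipschitz = K * L + discount M * (L * (C / (1 - discount M)) * measure (state_space M) (states M))"

lemma Q_lipschitz_nonneg: "0 \<le> Q_lipschitz"
  using nonneg discount by (simp add: Q_lipschitz_def)

text \<open>On the right of the Bellman equation the action occurs only in the reward and the
  transition, so V is treated as a fixed bounded function.\<close>

lemma
  assumes \<theta>: "\<theta> \<in> \<Theta>" and s: "s \<in> states M" and a: "a \<in> actions M"
  shows Q_value_differentiable: "Q_value M (pol \<theta>) \<psi> s differentiable (at a)"
    and norm_gradient_Q_value_le: "norm (gradient (Q_value M (pol \<theta>) \<psi> s) a) \<le> Q_lipschitz"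
proof -
  interpret P: bounded_utility_mdp M "pol \<theta>" \<psi> B C by (rule bounded_utility[OF \<theta>])
  obtain e where e: "0 < e" "ball a e \<subseteq> actions M" by (rule obtain_action_ball[OF a])
  obtain D1 where D1: "GDERIV (P.expected_utility s) a :> D1" "norm D1 \<le> K * L"
    unfolding P.expected_utility_def[abs_def] by (rule GDERIV_expected_utility[OF s a])
  have "0 \<le> C / (1 - discount M)" using nonneg discount by simp
  then obtain D2 where D2: "GDERIV (trans_op (V_value M (pol \<theta>) \<psi>) s) a :> D2"
    "norm D2 \<le> L * (C / (1 - discount M)) * measure (state_space M) (states M)"
    by (rule GDERIV_trans_op[OF s a P.bounded_V_value])
  have "GDERIV (\<lambda>a. P.expected_utility s a + discount M * trans_op (V_value M (pol \<theta>) \<psi>) s a) a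
      :> D1 + discount M *\<^sub>R D2"
    using GDERIV_add[OF D1(1) GDERIV_mult[OF GDERIV_const[of "discount M"] D2(1)]] by simp
  then have Q: "GDERIV (Q_value M (pol \<theta>) \<psi> s) a :> D1 + discount M *\<^sub>R D2"
    by (rule GDERIV_cong_ball[OF _ e(1)]) (use e s in \<open>auto simp: P.Q_value_bellman\<close>)
  then show "Q_value M (pol \<theta>) \<psi> s differentiable (at a)"
    unfolding gderiv_def differentiable_def by blast
  have "norm (D1 + discount M *\<^sub>R D2) \<le> norm D1 + discount M * norm D2"
    using norm_triangle_ineq[of D1 "discount M *\<^sub>R D2"] discount by simp
  also have "\<dots> \<le> Q_lipschitz"
    unfolding Q_lipschitz_def using D1(2) D2(2) discount by (intro add_mono mult_left_mono) auto
  finally show "norm (gradient (Q_value M (pol \<theta>) \<psi> s) a) \<le> Q_lipschitz"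
    unfolding gradient_eqI[OF Q] .
qed

lemma GDERIV_policy:
  assumes "s \<in> states M" "\<xi> \<in> X" "\<theta> \<in> \<Theta>" and D: "GDERIV f (\<pi> s \<xi> \<theta>) :> D"
  shows "GDERIV (\<lambda>\<theta>. f (\<pi> s \<xi> \<theta>)) \<theta> :> blinfun_apply (jacobian_transpose (\<pi> s \<xi>) \<theta>) D"
proof -
  have "\<pi> s \<xi> differentiable (at \<theta>)"
    using regular_policy assms by (auto simp: regular_policy_def)
  then obtain p where p: "(\<pi> s \<xi> has_derivative p) (at \<theta>)"
    by (auto simp: differentiable_def)
  from has_derivative_compose[OF p D[unfolded gderiv_def]]
  show ?thesis unfolding gderiv_def by (simp add: jacobian_transpose_inner[OF p])
qed

lemma policy_lipschitz:
  assumes s: "s \<in> states M" and \<xi>: "\<xi> \<in> X"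
    and D: "\<And>a. a \<in> actions M \<Longrightarrow> \<exists>D. GDERIV f a :> D \<and> norm D \<le> c"
    and e: "0 < e" "ball \<theta> e \<subseteq> \<Theta>" and \<theta>': "\<theta>' \<in> ball \<theta> e"
    and g: "\<And>\<theta>'. \<theta>' \<in> ball \<theta> e \<Longrightarrow> norm (jacobian_transpose (\<pi> s \<xi>) \<theta>') \<le> g"
  shows "\<bar>f (\<pi> s \<xi> \<theta>') - f (\<pi> s \<xi> \<theta>)\<bar> \<le> c * g * norm (\<theta>' - \<theta>)"
proof -
  obtain G where G: "GDERIV f a :> G a" "norm (G a) \<le> c" if "a \<in> actions M" for a
    using D by metis
  show ?thesis
  proof (rule GDERIV_imp_bounded_diff)
    fix \<theta>' assume \<theta>': "\<theta>' \<in> ball \<theta> e"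
    then have a: "\<theta>' \<in> \<Theta>" "\<pi> s \<xi> \<theta>' \<in> actions M" using e s \<xi> policy_actions by auto
    show "GDERIV (\<lambda>\<theta>. f (\<pi> s \<xi> \<theta>)) \<theta>' :> blinfun_apply (jacobian_transpose (\<pi> s \<xi>) \<theta>') (G (\<pi> s \<xi> \<theta>'))"
      by (rule GDERIV_policy[OF s \<xi> a(1) G(1)[OF a(2)]])
    have "norm (blinfun_apply (jacobian_transpose (\<pi> s \<xi>) \<theta>') (G (\<pi> s \<xi> \<theta>')))
        \<le> norm (jacobian_transpose (\<pi> s \<xi>) \<theta>') * norm (G (\<pi> s \<xi> \<theta>'))"
      by (rule norm_blinfun)
    also have "\<dots> \<le> g * c"
      using g[OF \<theta>'] G(2)[OF a(2)] order_trans[OF norm_ge_zero g[OF \<theta>']] by (intro mult_mono) auto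
    finally show "norm (blinfun_apply (jacobian_transpose (\<pi> s \<xi>) \<theta>') (G (\<pi> s \<xi> \<theta>'))) \<le> c * g"
      by (simp add: mult.commute)
  qed (use e \<theta>' in auto)
qed

end

section \<open>The policy gradient\<close>

context mdp
begin

lemma bounded_state_funD:
  assumes "bounded_state_fun D f"
  shows "f \<in> borel_measurable (state_space M)" "s \<in> states M \<Longrightarrow> \<bar>f s\<bar> \<le> D"
  using assms by (auto simp: bounded_state_fun_def)

lemma bounded_state_fun_diff:
  assumes "bounded_state_fun D f" "bounded_state_fun E g"
  shows "bounded_state_fun (D + E) (\<lambda>s. f s - g s)"
proof -
  have "\<bar>f s - g s\<bar> \<le> D + E" if "s \<in> states M" for s
    using bounded_state_funD(2)[OF assms(1) that] bounded_state_funD(2)[OF assms(2) that] by linarith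
  then show ?thesis
    using bounded_state_funD(1)[OF assms(1)] bounded_state_funD(1)[OF assms(2)]
    by (simp add: bounded_state_fun_def)
qed

lemma trans_op_diff:
  assumes "bounded_state_fun D f" "bounded_state_fun E g" and s: "s \<in> states M" "a \<in> actions M"
  shows "trans_op (\<lambda>s. f s - g s) s a = trans_op f s a - trans_op g s a"
proof -
  have "integrable (trans_kernel M s a) h" if "bounded_state_fun c h" for c h
    using bounded_state_funD[OF that]
    by (intro integrable_prob_algebra[OF trans_kernel_prob_algebra[OF s], of _ c]) (auto simp: space_state_space)
  then show ?thesis
    unfolding trans_op_def using assms(1,2) by (intro Bochner_Integration.integral_diff)
qed

lemma states_nonempty: "states M \<noteq> {}"
  using prob_space.not_empty[OF prob_init] by (simp add: init_law_def space_state_space)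

text \<open>The sup norm E of \<open>f\<close> satisfies E \<le> c + \<gamma> E. The a priori bound
  \<open>D\<close> makes E finite, which solving for E requires.\<close>

lemma bounded_state_fun_contraction:
  assumes b: "bounded_state_fun D f"
    and step: "\<And>E s. bounded_state_fun E f \<Longrightarrow> s \<in> states M \<Longrightarrow> \<bar>f s\<bar> \<le> c + discount M * E"
  shows "bounded_state_fun (c / (1 - discount M)) f"
proof -
  let ?E = "SUP s\<in>states M. \<bar>f s\<bar>"
  have bdd: "bdd_above ((\<lambda>s. \<bar>f s\<bar>) ` states M)"
    using bounded_state_funD(2)[OF b] by (auto simp: bdd_above_def)
  have E: "bounded_state_fun ?E f"
    using bounded_state_funD(1)[OF b] cSUP_upper[OF _ bdd] by (auto simp: bounded_state_fun_def)
  have "?E \<le> c + discount M * ?E"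
    using step[OF E] by (intro cSUP_least states_nonempty)
  then have "?E * (1 - discount M) \<le> c" by (simp add: algebra_simps)
  then have "?E \<le> c / (1 - discount M)" using discount by (simp add: pos_le_divide_eq)
  then show ?thesis
    using E by (auto simp: bounded_state_fun_def intro: order_trans)
qed

end

context push_forward_mdp
begin

section \<open>Estimates near a fixed parameter\<close>

context
  fixes \<theta> e and g :: "'x \<Rightarrow> real"
  assumes e: "0 < e" "ball \<theta> e \<subseteq> \<Theta>" and g: "integrable \<Xi> g"
    and jacobian_le: "\<And>\<theta>' s \<xi>. \<lbrakk>\<theta>' \<in> ball \<theta> e; s \<in> states M; \<xi> \<in> X\<rbrakk>
      \<Longrightarrow> norm (jacobian_transpose (\<pi> s \<xi>) \<theta>') \<le> g \<xi>"
begin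

interpretation base: prob_space \<Xi> by (rule prob_base)

interpretation S: finite_measure "state_space M" by (rule finite_measure_state_space)

interpretation pair_sigma_finite "state_space M" \<Xi> ..

lemma base_param: "\<theta> \<in> \<Theta>"
  using e by auto

interpretation P: bounded_utility_mdp M "pol \<theta>" \<psi> B C
  by (rule bounded_utility[OF base_param])

abbreviation "Q \<equiv> Q_value M (pol \<theta>) \<psi>"
abbreviation "V \<equiv> V_value M (pol \<theta>) \<psi>"
abbreviation "G \<equiv> \<lambda>s \<xi>. blinfun_apply (jacobian_transpose (\<pi> s \<xi>) \<theta>) (gradient (Q s) (\<pi> s \<xi> \<theta>))"
abbreviation "occ \<equiv> occupancy M (pol \<theta>)"
abbreviation "Eg \<equiv> \<integral>\<xi>. g \<xi> \<partial>\<Xi>"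

text \<open>\<open>g\<close> is known only as a bound of norms, so its sign is read off at some
  state, which exists because the initial law is a probability measure.\<close>

lemma g_nonneg: "\<xi> \<in> X \<Longrightarrow> 0 \<le> g \<xi>"
  using states_nonempty jacobian_le[of \<theta>] e norm_ge_zero order_trans by (metis all_not_in_conv centre_in_ball)

lemma Eg_nonneg: "0 \<le> Eg"
  by (rule Bochner_Integration.integral_nonneg) (simp add: g_nonneg space_base)

text \<open>For each \<xi> the integrand moves by at most c times g(\<xi>) times \<bar>\<theta>' -
  \<theta>\<bar>, so averaging involves only the first moment of \<open>g\<close>. It serves twice:
  with \<open>Q\<close> for the first-order term and with the transition of W for the error.\<close>

lemma policy_op_diff_le:
  assumes h: "bounded_action_fun D h" and \<theta>': "\<theta>' \<in> ball \<theta> e" and s: "s \<in> states M"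
    and grad: "\<And>a. a \<in> actions M \<Longrightarrow> \<exists>D. GDERIV (h s) a :> D \<and> norm D \<le> c"
  shows "\<bar>mdp_policy.policy_op (pol \<theta>') h s - P.policy_op h s\<bar> \<le> c * Eg * norm (\<theta>' - \<theta>)"
proof -
  have \<theta>\<Theta>: "\<theta>' \<in> \<Theta>" using \<theta>' e by auto
  note int = bounded_action_funD(2)[OF \<theta>\<Theta> h s] bounded_action_funD(2)[OF base_param h s]
  have "\<bar>mdp_policy.policy_op (pol \<theta>') h s - P.policy_op h s\<bar>
      = \<bar>\<integral>\<xi>. h s (\<pi> s \<xi> \<theta>') - h s (\<pi> s \<xi> \<theta>) \<partial>\<Xi>\<bar>"
    using int by (simp add: policy_op_push_forward[OF \<theta>\<Theta> h s] policy_op_push_forward[OF base_param h s])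
  also have "\<dots> \<le> (\<integral>\<xi>. \<bar>h s (\<pi> s \<xi> \<theta>') - h s (\<pi> s \<xi> \<theta>)\<bar> \<partial>\<Xi>)"
    by (rule integral_abs_bound)
  also have "\<dots> \<le> (\<integral>\<xi>. c * g \<xi> * norm (\<theta>' - \<theta>) \<partial>\<Xi>)"
  proof (rule integral_mono)
    show "\<bar>h s (\<pi> s \<xi> \<theta>') - h s (\<pi> s \<xi> \<theta>)\<bar> \<le> c * g \<xi> * norm (\<theta>' - \<theta>)" if "\<xi> \<in> space \<Xi>" for \<xi>
      using that jacobian_le[OF _ s]
      by (intro policy_lipschitz[OF s _ grad e \<theta>']) (auto simp: space_base)
  qed (use int g in auto)
  also have "\<dots> = c * Eg * norm (\<theta>' - \<theta>)" by simp
  finally show ?thesis .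
qed

lemma Q_gradient:
  assumes "s \<in> states M" "a \<in> actions M"
  shows "GDERIV (Q s) a :> gradient (Q s) a" "norm (gradient (Q s) a) \<le> Q_lipschitz"
  using gderiv_gradient[OF Q_value_differentiable[OF base_param assms]]
    norm_gradient_Q_value_le[OF base_param assms] by auto

text \<open>The first-order part of the change of \<open>V\<close>, called \<open>A\<close> above.\<close>

abbreviation "advantage \<theta>' s \<equiv> mdp_policy.policy_op (pol \<theta>') Q s - V s"

lemma advantage_le:
  assumes "\<theta>' \<in> ball \<theta> e" "s \<in> states M"
  shows "\<bar>advantage \<theta>' s\<bar> \<le> Q_lipschitz * Eg * norm (\<theta>' - \<theta>)"
  unfolding P.V_value_eq
  using Q_gradient[OF assms(2)] by (intro policy_op_diff_le[OF P.bounded_Q_value assms]) blast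

text \<open>Expected utility does not depend on the policy, so at a common action the two Bellman
  equations differ only by the discounted transition of W. Averaging over the actions of \<theta>'
  gives an exact identity without remainder.\<close>

lemma performance_difference:
  assumes \<theta>': "\<theta>' \<in> ball \<theta> e" and s: "s \<in> states M"
  defines "W \<equiv> \<lambda>s. V_value M (pol \<theta>') \<psi> s - V s"
  shows "W s = advantage \<theta>' s + discount M * mdp_policy.policy_op (pol \<theta>') (trans_op W) s"
proof -
  have \<theta>\<Theta>: "\<theta>' \<in> \<Theta>" using \<theta>' e by auto
  interpret P': bounded_utility_mdp M "pol \<theta>'" \<psi> B C by (rule bounded_utility[OF \<theta>\<Theta>])
  let ?D = "C / (1 - discount M)"
  note bV = P.bounded_V_value and bV' = P'.bounded_V_value
  note bT = bounded_trans_op[OF bounded_state_fun_diff[OF bV' bV]]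
  have "Q_value M (pol \<theta>') \<psi> s a = Q s a + discount M * trans_op W s a" if a: "a \<in> actions M" for a
    unfolding W_def trans_op_diff[OF bV' bV s a] P.Q_value_bellman[OF s a] P'.Q_value_bellman[OF s a]
    by (simp add: algebra_simps)
  then have "P'.policy_op (Q_value M (pol \<theta>') \<psi>) s
      = (\<integral>\<xi>. Q s (\<pi> s \<xi> \<theta>') + discount M * trans_op W s (\<pi> s \<xi> \<theta>') \<partial>\<Xi>)"
    unfolding policy_op_push_forward[OF \<theta>\<Theta> P'.bounded_Q_value s]
    using policy_actions[OF s _ \<theta>\<Theta>] by (intro Bochner_Integration.integral_cong) (auto simp: space_base)
  also have "\<dots> = P'.policy_op Q s + discount M * P'.policy_op (trans_op W) s"
    unfolding W_def policy_op_push_forward[OF \<theta>\<Theta> P.bounded_Q_value s] policy_op_push_forward[OF \<theta>\<Theta> bT s]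
    using bounded_action_funD(2)[OF \<theta>\<Theta> P.bounded_Q_value s] bounded_action_funD(2)[OF \<theta>\<Theta> bT s] by simp
  finally show ?thesis by (simp add: W_def P'.V_value_eq)
qed

abbreviation "V_lipschitz \<equiv> Q_lipschitz * Eg / (1 - discount M)"

lemma V_value_diff_le:
  assumes \<theta>': "\<theta>' \<in> ball \<theta> e"
  shows "bounded_state_fun (V_lipschitz * norm (\<theta>' - \<theta>)) (\<lambda>s. V_value M (pol \<theta>') \<psi> s - V s)"
proof -
  have \<theta>\<Theta>: "\<theta>' \<in> \<Theta>" using \<theta>' e by auto
  interpret P': bounded_utility_mdp M "pol \<theta>'" \<psi> B C by (rule bounded_utility[OF \<theta>\<Theta>])
  let ?W = "\<lambda>s. V_value M (pol \<theta>') \<psi> s - V s"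
  have "bounded_state_fun (Q_lipschitz * Eg * norm (\<theta>' - \<theta>) / (1 - discount M)) ?W"
  proof (rule bounded_state_fun_contraction[OF bounded_state_fun_diff[OF P'.bounded_V_value P.bounded_V_value]])
    fix E s assume E: "bounded_state_fun E ?W" and s: "s \<in> states M"
    have "\<bar>P'.policy_op (trans_op ?W) s\<bar> \<le> E"
      by (rule bounded_state_funD(2)[OF P'.bounded_policy_op[OF bounded_trans_op[OF E]] s])
    then have "\<bar>discount M * P'.policy_op (trans_op ?W) s\<bar> \<le> discount M * E"
      using discount by (simp add: abs_mult mult_left_mono)
    then show "\<bar>?W s\<bar> \<le> Q_lipschitz * Eg * norm (\<theta>' - \<theta>) + discount M * E"
      using performance_difference[OF \<theta>' s] advantage_le[OF \<theta>' s] by linarith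
  qed
  then show ?thesis by simp
qed

text \<open>The mass of the occupancy, the discount, the Lipschitz constant in the action of the
  transition of W per unit of parameter change, and \<open>Eg\<close> for the change of the
  actions.\<close>

definition "quadratic_constant =
  (\<integral>s. \<bar>occ s\<bar> \<partial>state_space M) * (discount M * (L * V_lipschitz * measure (state_space M) (states M)) * Eg)"

lemma integrable_occ: "integrable (state_space M) occ"
  using P.integrable_occupancy[OF P.bounded_one] by simp

lemma state_utility_expansion:
  assumes \<theta>': "\<theta>' \<in> ball \<theta> e"
  shows "\<bar>state_utility M (pol \<theta>') \<psi> - state_utility M (pol \<theta>) \<psi>
      - (\<integral>s. occ s * advantage \<theta>' s \<partial>state_space M)\<bar> \<le> quadratic_constant * (norm (\<theta>' - \<theta>))\<^sup>2"
proof -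
  have \<theta>\<Theta>: "\<theta>' \<in> \<Theta>" using \<theta>' e by auto
  interpret P': bounded_utility_mdp M "pol \<theta>'" \<psi> B C by (rule bounded_utility[OF \<theta>\<Theta>])
  let ?W = "\<lambda>s. V_value M (pol \<theta>') \<psi> s - V s" and ?n = "norm (\<theta>' - \<theta>)"
  let ?c = "L * (V_lipschitz * ?n) * measure (state_space M) (states M)"
  let ?R = "\<lambda>s. P'.policy_op (trans_op ?W) s - P.policy_op (trans_op ?W) s"
  note bW = V_value_diff_le[OF \<theta>']
  note bT = bounded_trans_op[OF bW]
  have nn: "0 \<le> V_lipschitz * ?n"
    using Q_lipschitz_nonneg Eg_nonneg discount by simp
  have bA: "bounded_state_fun (C / (1 - discount M) + C / (1 - discount M)) (advantage \<theta>')"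
    by (rule bounded_state_fun_diff[OF P'.bounded_policy_op[OF P.bounded_Q_value] P.bounded_V_value])
  \<comment> \<open>\<open>?c\<close> already contains one factor \<open>?n\<close>, from the size
    of W; the change of policy supplies the second.\<close>
  have R_le: "\<bar>?R s\<bar> \<le> ?c * Eg * ?n" if s: "s \<in> states M" for s
  proof (rule policy_op_diff_le[OF bT \<theta>' s])
    fix a assume a: "a \<in> actions M"
    show "\<exists>D. GDERIV (trans_op ?W s) a :> D \<and> norm D \<le> ?c"
      by (rule GDERIV_trans_op[OF s a bW nn]) blast
  qed
  have bR: "bounded_state_fun (?c * Eg * ?n) ?R"
    using R_le bounded_state_funD(1)[OF P'.bounded_policy_op[OF bT]] bounded_state_funD(1)[OF P.bounded_policy_op[OF bT]]
    by (simp add: bounded_state_fun_def)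
  have int: "integrable (init_law M) f" if "bounded_state_fun D f" for D f
    using bounded_state_funD[OF that]
    by (intro integrable_prob_algebra[OF init_law_prob_algebra, of _ D]) (auto simp: space_state_space)
  have "state_utility M (pol \<theta>') \<psi> - state_utility M (pol \<theta>) \<psi> = (\<integral>s. ?W s \<partial>init_law M)"
    unfolding state_utility_def
    by (rule Bochner_Integration.integral_diff[OF int int, symmetric])
      (rule P'.bounded_V_value P.bounded_V_value)+
  also have "\<dots> = (\<integral>s. occ s * (?W s - discount M * P.policy_op (trans_op ?W) s) \<partial>state_space M)"
    by (rule P.occupancy_balance[OF bW, symmetric])
  \<comment> \<open>The identity for W holds with T at \<theta>', the balance with T at \<theta>;
    \<open>?R\<close> is the discrepancy.\<close>
  also have "\<dots> = (\<integral>s. occ s * advantage \<theta>' s + discount M * (occ s * ?R s) \<partial>state_space M)"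
  proof (rule Bochner_Integration.integral_cong[OF refl])
    fix s assume "s \<in> space (state_space M)"
    then have "?W s - discount M * P.policy_op (trans_op ?W) s = advantage \<theta>' s + discount M * ?R s"
      using performance_difference[OF \<theta>', of s] by (simp add: space_state_space algebra_simps)
    then show "occ s * (?W s - discount M * P.policy_op (trans_op ?W) s)
        = occ s * advantage \<theta>' s + discount M * (occ s * ?R s)"
      by (simp only: distrib_left mult.left_commute)
  qed
  also have "\<dots> = (\<integral>s. occ s * advantage \<theta>' s \<partial>state_space M) + discount M * (\<integral>s. occ s * ?R s \<partial>state_space M)"
    using P.integrable_occupancy[OF bA] P.integrable_occupancy[OF bR] by simp
  finally have eq: "state_utility M (pol \<theta>') \<psi> - state_utility M (pol \<theta>) \<psi>
      - (\<integral>s. occ s * advantage \<theta>' s \<partial>state_space M) = discount M * (\<integral>s. occ s * ?R s \<partial>state_space M)"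
    by simp
  have "\<bar>\<integral>s. occ s * ?R s \<partial>state_space M\<bar> \<le> (\<integral>s. \<bar>occ s * ?R s\<bar> \<partial>state_space M)"
    by (rule integral_abs_bound)
  also have "\<dots> \<le> (\<integral>s. \<bar>occ s\<bar> * (?c * Eg * ?n) \<partial>state_space M)"
  proof (rule integral_mono)
    show "\<bar>occ s * ?R s\<bar> \<le> \<bar>occ s\<bar> * (?c * Eg * ?n)" if "s \<in> space (state_space M)" for s
      unfolding abs_mult using that R_le by (intro mult_left_mono) (auto simp: space_state_space)
  qed (use integrable_occ P.integrable_occupancy[OF bR] in auto)
  also have "\<dots> = (\<integral>s. \<bar>occ s\<bar> \<partial>state_space M) * (?c * Eg * ?n)" by simp
  finally have "\<bar>discount M\<bar> * \<bar>\<integral>s. occ s * ?R s \<partial>state_space M\<bar>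
      \<le> \<bar>discount M\<bar> * ((\<integral>s. \<bar>occ s\<bar> \<partial>state_space M) * (?c * Eg * ?n))"
    by (rule mult_left_mono) simp
  then have "\<bar>discount M * (\<integral>s. occ s * ?R s \<partial>state_space M)\<bar>
      \<le> discount M * ((\<integral>s. \<bar>occ s\<bar> \<partial>state_space M) * (?c * Eg * ?n))"
    unfolding abs_mult using discount by simp
  then show ?thesis
    unfolding eq quadratic_constant_def by (simp add: power2_eq_square mult_ac)
qed

lemma integrable_pair_mult:
  assumes "integrable (state_space M) u" "integrable \<Xi> v"
  shows "integrable (state_space M \<Otimes>\<^sub>M \<Xi>) (\<lambda>z. u (fst z) * v (snd z) :: real)"
proof -
  have [measurable]: "u \<in> borel_measurable (state_space M)" "v \<in> borel_measurable \<Xi>"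
    using assms by auto
  show ?thesis
    by (rule Fubini_integrable) (use assms in \<open>auto simp: abs_mult\<close>)
qed

lemma integrable_occ_action_fun:
  assumes \<theta>: "\<theta>' \<in> \<Theta>" and h: "bounded_action_fun D h"
  shows "integrable (state_space M \<Otimes>\<^sub>M \<Xi>) (\<lambda>z. occ (fst z) * h (fst z) (\<pi> (fst z) (snd z) \<theta>'))"
proof (rule Bochner_Integration.integrable_bound)
  show "integrable (state_space M \<Otimes>\<^sub>M \<Xi>) (\<lambda>z. \<bar>occ (fst z)\<bar> * D)"
    using integrable_pair_mult[of "\<lambda>s. \<bar>occ s\<bar>" "\<lambda>_. D"] integrable_occ by simp
  have [measurable]: "(\<lambda>z. h (fst z) (\<pi> (fst z) (snd z) \<theta>')) \<in> borel_measurable (state_space M \<Otimes>\<^sub>M \<Xi>)"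
    using h by (intro measurable_state_policy[OF \<theta>]) (simp add: bounded_action_fun_def)
  have [measurable]: "occ \<in> borel_measurable (state_space M)" using integrable_occ by auto
  show "(\<lambda>z. occ (fst z) * h (fst z) (\<pi> (fst z) (snd z) \<theta>')) \<in> borel_measurable (state_space M \<Otimes>\<^sub>M \<Xi>)"
    by measurable
  show "AE z in state_space M \<Otimes>\<^sub>M \<Xi>. norm (occ (fst z) * h (fst z) (\<pi> (fst z) (snd z) \<theta>')) \<le> norm (\<bar>occ (fst z)\<bar> * D)"
  proof (rule AE_I2)
    fix z assume "z \<in> space (state_space M \<Otimes>\<^sub>M \<Xi>)"
    then have "\<bar>h (fst z) (\<pi> (fst z) (snd z) \<theta>')\<bar> \<le> D"
      using h policy_actions[OF _ _ \<theta>] by (auto simp: bounded_action_fun_def space_state_base)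
    then show "norm (occ (fst z) * h (fst z) (\<pi> (fst z) (snd z) \<theta>')) \<le> norm (\<bar>occ (fst z)\<bar> * D)"
      by (auto simp: abs_mult intro!: mult_left_mono)
  qed
qed

text \<open>State and noise are treated in one product integral, so a single differentiation under
  the integral yields joint integrability and the gradient. The dominating function is a product of
  an integrable function of the state and one of the noise.\<close>

lemma policy_gradient:
  shows "integrable (state_space M \<Otimes>\<^sub>M \<Xi>) (\<lambda>(s, \<xi>). occ s *\<^sub>R G s \<xi>)"
    and "GDERIV (\<lambda>\<theta>. state_utility M (pol \<theta>) \<psi>) \<theta> :>
      (\<integral>s. occ s *\<^sub>R (\<integral>\<xi>. G s \<xi> \<partial>\<Xi>) \<partial>state_space M)"
proof -
  let ?f = "\<lambda>\<theta>' z. occ (fst z) * Q (fst z) (\<pi> (fst z) (snd z) \<theta>')"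
  let ?G = "\<lambda>z. occ (fst z) *\<^sub>R G (fst z) (snd z)"
  let ?g = "\<lambda>z. \<bar>occ (fst z)\<bar> * (Q_lipschitz * g (snd z))"
  have f_int: "integrable (state_space M \<Otimes>\<^sub>M \<Xi>) (?f \<theta>')" if "\<theta>' \<in> ball \<theta> e" for \<theta>'
    using that e by (intro integrable_occ_action_fun[OF _ P.bounded_Q_value]) auto
  have f_deriv: "GDERIV (\<lambda>\<theta>'. ?f \<theta>' z) \<theta> :> ?G z" if "z \<in> space (state_space M \<Otimes>\<^sub>M \<Xi>)" for z
  proof -
    have z: "fst z \<in> states M" "snd z \<in> X" using that by (auto simp: space_state_base)
    from GDERIV_policy[OF z base_param Q_gradient(1)[OF z(1) policy_actions[OF z base_param]]]
    show ?thesis using GDERIV_mult[OF GDERIV_const[of "occ (fst z)"]] by fastforce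
  qed
  have g_int: "integrable (state_space M \<Otimes>\<^sub>M \<Xi>) ?g"
    using integrable_occ g by (intro integrable_pair_mult[of "\<lambda>s. \<bar>occ s\<bar>" "\<lambda>\<xi>. Q_lipschitz * g \<xi>"]) auto
  have g_nn: "0 \<le> ?g z" if "z \<in> space (state_space M \<Otimes>\<^sub>M \<Xi>)" for z
    using that g_nonneg Q_lipschitz_nonneg by (intro mult_nonneg_nonneg) (auto simp: space_state_base)
  have f_lip: "\<bar>?f \<theta>' z - ?f \<theta> z\<bar> \<le> ?g z * norm (\<theta>' - \<theta>)"
    if "\<theta>' \<in> ball \<theta> e" "z \<in> space (state_space M \<Otimes>\<^sub>M \<Xi>)" for \<theta>' z
  proof -
    have z: "fst z \<in> states M" "snd z \<in> X" using that by (auto simp: space_state_base)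
    have "\<bar>Q (fst z) (\<pi> (fst z) (snd z) \<theta>') - Q (fst z) (\<pi> (fst z) (snd z) \<theta>)\<bar>
        \<le> Q_lipschitz * g (snd z) * norm (\<theta>' - \<theta>)"
      using Q_gradient[OF z(1)] jacobian_le[OF _ z] by (intro policy_lipschitz[OF z _ e that(1)]) auto
    then have "\<bar>occ (fst z)\<bar> * \<bar>Q (fst z) (\<pi> (fst z) (snd z) \<theta>') - Q (fst z) (\<pi> (fst z) (snd z) \<theta>)\<bar>
        \<le> \<bar>occ (fst z)\<bar> * (Q_lipschitz * g (snd z) * norm (\<theta>' - \<theta>))"
      by (intro mult_left_mono) auto
    then show ?thesis
      by (simp only: right_diff_distrib[symmetric] abs_mult mult.assoc)
  qed
  note dom = dominated_GDERIV[where f = ?f and G = ?G, OF e(1) f_int f_deriv g_int g_nn f_lip]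
  have G_int: "integrable (state_space M \<Otimes>\<^sub>M \<Xi>) ?G" by (rule dom(1))
  then show "integrable (state_space M \<Otimes>\<^sub>M \<Xi>) (\<lambda>(s, \<xi>). occ s *\<^sub>R G s \<xi>)"
    by (simp add: split_beta')
  have "(\<integral>z. ?G z \<partial>(state_space M \<Otimes>\<^sub>M \<Xi>)) = (\<integral>s. (\<integral>\<xi>. occ s *\<^sub>R G s \<xi> \<partial>\<Xi>) \<partial>state_space M)"
    using integral_fst'[OF G_int] by simp
  also have "\<dots> = (\<integral>s. occ s *\<^sub>R (\<integral>\<xi>. G s \<xi> \<partial>\<Xi>) \<partial>state_space M)" by simp
  finally have G_eq: "(\<integral>z. ?G z \<partial>(state_space M \<Otimes>\<^sub>M \<Xi>))
      = (\<integral>s. occ s *\<^sub>R (\<integral>\<xi>. G s \<xi> \<partial>\<Xi>) \<partial>state_space M)" .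
  have H: "(\<integral>z. ?f \<theta>' z \<partial>(state_space M \<Otimes>\<^sub>M \<Xi>))
      = (\<integral>s. occ s * mdp_policy.policy_op (pol \<theta>') Q s \<partial>state_space M)" if "\<theta>' \<in> ball \<theta> e" for \<theta>'
  proof -
    have \<theta>\<Theta>: "\<theta>' \<in> \<Theta>" using that e by auto
    have "(\<integral>z. ?f \<theta>' z \<partial>(state_space M \<Otimes>\<^sub>M \<Xi>)) = (\<integral>s. (\<integral>\<xi>. occ s * Q s (\<pi> s \<xi> \<theta>') \<partial>\<Xi>) \<partial>state_space M)"
      using integral_fst'[OF f_int[OF that]] by simp
    also have "\<dots> = (\<integral>s. occ s * mdp_policy.policy_op (pol \<theta>') Q s \<partial>state_space M)"
      using bounded_action_funD(2)[OF \<theta>\<Theta> P.bounded_Q_value]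
      by (intro Bochner_Integration.integral_cong)
        (auto simp: space_state_space policy_op_push_forward[OF \<theta>\<Theta> P.bounded_Q_value])
    finally show ?thesis .
  qed
  show "GDERIV (\<lambda>\<theta>. state_utility M (pol \<theta>) \<psi>) \<theta> :> (\<integral>s. occ s *\<^sub>R (\<integral>\<xi>. G s \<xi> \<partial>\<Xi>) \<partial>state_space M)"
    unfolding G_eq[symmetric]
  proof (rule GDERIV_quadratic_error[OF _ e(1)])
    show "GDERIV (\<lambda>\<theta>'. \<integral>z. ?f \<theta>' z \<partial>(state_space M \<Otimes>\<^sub>M \<Xi>)) \<theta> :> (\<integral>z. ?G z \<partial>(state_space M \<Otimes>\<^sub>M \<Xi>))"
      by (rule dom(2))
    fix \<theta>' assume \<theta>': "\<theta>' \<in> ball \<theta> e"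
    then have \<theta>\<Theta>: "\<theta>' \<in> \<Theta>" using e by auto
    interpret P': bounded_utility_mdp M "pol \<theta>'" \<psi> B C by (rule bounded_utility[OF \<theta>\<Theta>])
    \<comment> \<open>The average of \<open>Q\<close> over the actions of \<theta> itself is V, so
      the integrated advantage is exactly the increment of the function just differentiated.\<close>
    have "(\<integral>s. occ s * advantage \<theta>' s \<partial>state_space M)
        = (\<integral>z. ?f \<theta>' z \<partial>(state_space M \<Otimes>\<^sub>M \<Xi>)) - (\<integral>z. ?f \<theta> z \<partial>(state_space M \<Otimes>\<^sub>M \<Xi>))"
      using P.integrable_occupancy[OF P'.bounded_policy_op[OF P.bounded_Q_value]]
        P.integrable_occupancy[OF P.bounded_policy_op[OF P.bounded_Q_value]] e(1)
      by (simp add: H[OF \<theta>'] H[of \<theta>] P.V_value_eq right_diff_distrib)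
    then show "\<bar>state_utility M (pol \<theta>') \<psi> - state_utility M (pol \<theta>) \<psi>
        - ((\<integral>z. ?f \<theta>' z \<partial>(state_space M \<Otimes>\<^sub>M \<Xi>)) - (\<integral>z. ?f \<theta> z \<partial>(state_space M \<Otimes>\<^sub>M \<Xi>)))\<bar>
        \<le> quadratic_constant * (norm (\<theta>' - \<theta>))\<^sup>2"
      using state_utility_expansion[OF \<theta>'] by simp
  qed
qed

end

end

theorem theorem2:
  fixes M :: "('s::euclidean_space, 'a::euclidean_space, 'w) mdp"
    and X :: "'x::euclidean_space set"
    and \<Xi> :: "'x measure"
    and \<Theta> :: "'p::euclidean_space set"
    and \<pi> :: "'s \<Rightarrow> 'x \<Rightarrow> 'p \<Rightarrow> 'a"
    and \<psi> :: "real \<Rightarrow> real"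
    and \<theta> :: 'p
  assumes "mdp M"
    and "push_forward_policy M X \<Xi> \<Theta> \<pi>"
    and "regular_mdp M"
    and "regular_policy M X \<Theta> \<pi>"
    and "dominated_jacobian M \<Xi> \<Theta> \<pi>"
    and "\<forall>x. \<psi> differentiable (at x)"
    and "locally_bounded_deriv \<psi>"
    and "\<theta> \<in> \<Theta>"
  shows "let pol = push_forward M \<Xi> \<pi>;
             G = (\<lambda>s \<xi>. blinfun_apply (jacobian_transpose (\<pi> s \<xi>) \<theta>)
                    (gradient (Q_value M (pol \<theta>) \<psi> s) (\<pi> s \<xi> \<theta>)))
         in (\<forall>s\<in>states M. \<forall>a\<in>actions M. Q_value M (pol \<theta>) \<psi> s differentiable (at a)) \<and>
            integrable (state_space M \<Otimes>\<^sub>M \<Xi>) (\<lambda>(s, \<xi>). occupancy M (pol \<theta>) s *\<^sub>R G s \<xi>) \<and>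
            GDERIV (\<lambda>\<theta>. state_utility M (pol \<theta>) \<psi>) \<theta> :>
              (\<integral>s. occupancy M (pol \<theta>) s *\<^sub>R (\<integral>\<xi>. G s \<xi> \<partial>\<Xi>) \<partial>state_space M)"
proof -
  interpret mdp M by fact
  interpret push_forward_policy M X \<Xi> \<Theta> \<pi> by fact
  obtain B L where trans_le: "\<forall>s'\<in>states M. \<forall>s\<in>states M. \<forall>a\<in>actions M.
        trans_density M s' s a < B \<and> norm (gradient (trans_density M s' s) a) < L"
    and reward_le: "\<forall>s\<in>states M. \<forall>a\<in>actions M. \<forall>w\<in>space (noise M).
        \<bar>reward M s a w\<bar> < B \<and> norm (gradient (\<lambda>a. reward M s a w) a) < L"
    using assms(3) unfolding regular_mdp_def by (elim conjE exE)
  have DERIV: "DERIV \<psi> x :> deriv \<psi> x" for x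
    using assms(6) DERIV_deriv_iff_real_differentiable by blast
  \<comment> \<open>\<open>C\<close> comes from continuity on a compact interval containing all
    rewards; \<open>K\<close>, below, needs the boundedness condition on the derivative.\<close>
  have "continuous_on {-B..B} \<psi>"
    using DERIV DERIV_isCont by (blast intro: continuous_at_imp_continuous_on)
  then have "bounded (\<psi> ` {-B..B})"
    by (intro compact_imp_bounded compact_continuous_image) auto
  then obtain C where C: "0 < C" "\<forall>x\<in>\<psi> ` {-B..B}. norm x \<le> C"
    by (auto simp: bounded_pos)
  have "bounded (deriv \<psi> ` {-B..B})"
    using assms(7) unfolding locally_bounded_deriv_def by (simp add: bounded_closed_interval)
  then obtain K where K: "0 < K" "\<forall>x\<in>deriv \<psi> ` {-B..B}. norm x \<le> K"
    by (auto simp: bounded_pos)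
  \<comment> \<open>The absolute value is taken because the regularity condition states no sign for
    \<open>L\<close>.\<close>
  interpret push_forward_mdp M X \<Xi> \<Theta> \<pi> \<psi> B C K "\<bar>L\<bar>"
  proof unfold_locales
    show "regular_policy M X \<Theta> \<pi>" by fact
    show "DERIV \<psi> x :> deriv \<psi> x" for x by (rule DERIV)
    show "\<bar>deriv \<psi> x\<bar> \<le> K" "\<bar>\<psi> x\<bar> \<le> C" if "\<bar>x\<bar> \<le> B" for x
      using C(2) K(2) that by (auto simp: abs_le_iff)
    show "trans_density M s' s differentiable (at a)"
      if "s' \<in> states M" "s \<in> states M" "a \<in> actions M" for s' s a
      using assms(3) that by (simp add: regular_mdp_def)
    show "(\<lambda>a. reward M s a w) differentiable (at a)"
      if "s \<in> states M" "a \<in> actions M" "w \<in> space (noise M)" for s a w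
      using assms(3) that by (simp add: regular_mdp_def)
    show "norm (gradient (trans_density M s' s) a) \<le> \<bar>L\<bar>"
      if "s' \<in> states M" "s \<in> states M" "a \<in> actions M" for s' s a
      using trans_le[rule_format, OF that] by linarith
    show "\<bar>reward M s a w\<bar> \<le> B" "norm (gradient (\<lambda>a. reward M s a w) a) \<le> \<bar>L\<bar>"
      if "s \<in> states M" "a \<in> actions M" "w \<in> space (noise M)" for s a w
      using reward_le[rule_format, OF that] by linarith+
    show "0 \<le> C" "0 \<le> K" "0 \<le> \<bar>L\<bar>" using C(1) K(1) by simp_all
  qed
  obtain U g where U: "open U" "\<theta> \<in> U" "U \<subseteq> \<Theta>" and g: "integrable \<Xi> g"
    and le: "\<forall>\<theta>\<in>U. \<forall>s\<in>states M. \<forall>\<xi>\<in>space \<Xi>. norm (jacobian_transpose (\<pi> s \<xi>) \<theta>) \<le> g \<xi>"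
    using bspec[OF assms(5)[unfolded dominated_jacobian_def] assms(8)] by (elim exE conjE)
  \<comment> \<open>A ball is convex, as the mean value inequality requires.\<close>
  obtain e where e: "0 < e" "ball \<theta> e \<subseteq> U"
    using U unfolding open_contains_ball by blast
  have e': "ball \<theta> e \<subseteq> \<Theta>" using e U by blast
  have le': "norm (jacobian_transpose (\<pi> s \<xi>) \<theta>') \<le> g \<xi>"
    if "\<theta>' \<in> ball \<theta> e" "s \<in> states M" "\<xi> \<in> X" for \<theta>' s \<xi>
    using le e that by (auto simp: space_base)
  show ?thesis
    unfolding Let_def
    by (intro conjI ballI Q_value_differentiable[OF assms(8)] policy_gradient[OF e(1) e' g le'])
qed

end
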